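(* Let $(N^m(4\epsilon),J,\langle\cdot,\cdot\rangle)$ be a complex space form of complex dimension $m$ and constant holomorphic sectional curvature $4\epsilon$, and let $(M^m,g)$ be a Lagrangian submanifold of it, with isometric immersion $\phi:M^m\to N^m(4\epsilon)$. Then $\phi$ is biharmonic if and only if $$\mathrm{trace}_g(\nabla A_{\mathbf H})+\mathrm{trace}_g\big(A_{\nabla^\perp_\cdot\mathbf H}(\cdot)\big)=0,$$ $$\Delta^\perp\mathbf H+\mathrm{trace}_gB\big(A_{\mathbf H}(\cdot),\cdot\big)-(m+3)\,\epsilon\,\mathbf H=0.$$
   Context: The curvature tensor of $N=N^m(4\epsilon)$ is $R^N(U,V)W=\epsilon\{\langle V,W\rangle U-\langle U,W\rangle V+\langle W,JV\rangle JU-\langle W,JU\rangle JV+2\langle U,JV\rangle JW\}$, with the convention $R^N(U,V)=\nabla^N_U\nabla^N_V-\nabla^N_V\nabla^N_U-\nabla^N_{[U,V]}$. A submanifold $M^m$ of real dimension $m$ is Lagrangian if $J(T_xM)\subset T_xM^\perp$ for all $x\in M$; $g$ is the induced metric. Notation. $\nabla$, $\nabla^N$ are the Levi-Civita connections of $M$, $N$; $B$ is the second fundamental form, $\nabla^N_XY=\nabla_XY+B(X,Y)$; $A_\xi$ is the shape operator and $\nabla^\perp$ the normal connection, $\nabla^N_X\xi=-A_\xi X+\nabla^\perp_X\xi$. $\mathbf H=\frac1m\sum_iB(e_i,e_i)$ is the mean curvature vector field, $\{e_i\}$ a local orthonormal frame on $M$. $\mathrm{trace}_g(\nabla A_{\mathbf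 H})=\sum_i(\nabla_{e_i}A_{\mathbf H})(e_i)$; $\mathrm{trace}_g(A_{\nabla^\perp_\cdot\mathbf H}(\cdot))=\sum_iA_{\nabla^\perp_{e_i}\mathbf H}(e_i)$; $\mathrm{trace}_gB(A_{\mathbf H}(\cdot),\cdot)=\sum_iB(A_{\mathbf H}e_i,e_i)$; $\Delta^\perp=-\sum_i(\nabla^\perp_{e_i}\nabla^\perp_{e_i}-\nabla^\perp_{\nabla_{e_i}e_i})$. Biharmonic: an isometric immersion $\phi$ is biharmonic if $\overline\Delta\,\mathbf H-\sum_iR^N(\mathbf H,d\phi(e_i))d\phi(e_i)=0$, where $\overline\Delta=-\sum_k(\overline\nabla_{e_k}\overline\nabla_{e_k}-\overline\nabla_{\nabla_{e_k}e_k})$ is the rough Laplacian of the induced connection $\overline\nabla$ on $\phi^{-1}TN$. *)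

theory Defs
  imports "HOL-Analysis.Analysis"
begin

section \<open>Smooth maps between Euclidean spaces\<close>

abbreviation D :: "('v::real_normed_vector \<Rightarrow> 'w::real_normed_vector) \<Rightarrow> 'v \<Rightarrow> 'v \<Rightarrow> 'w"
  where "D f x \<equiv> frechet_derivative f (at x)"

text \<open>Only meaningful for open sets, which are the only ones it is used for.\<close>

primrec Ck_on :: "nat \<Rightarrow> 'v::real_normed_vector set \<Rightarrow> ('v \<Rightarrow> 'w::real_normed_vector) \<Rightarrow> bool"
  where
    "Ck_on 0 S f \<longleftrightarrow> continuous_on S f"
  | "Ck_on (Suc k) S f \<longleftrightarrow> (\<forall>x\<in>S. f differentiable (at x)) \<and> (\<forall>v. Ck_on k S (\<lambda>x. D f x v))"

definition smooth_on :: "'v::real_normed_vector set \<Rightarrow> ('v \<Rightarrow> 'w::real_normed_vector) \<Rightarrow> bool"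
  where "smooth_on S f \<longleftrightarrow> (\<forall>k. Ck_on k S f)"


section \<open>Smooth manifolds\<close>

type_synonym ('p, 'v) chart = "'p set \<times> ('p \<Rightarrow> 'v)"

text \<open>
  A manifold modelled on the Euclidean space 'v, with carrier \<open>topspace (space_of M)\<close>.
  Tensor fields are given by their components in the charts of the atlas: \<open>met M c x u v\<close> is the
  metric at the point with coordinates \<open>x\<close> in the chart \<open>c\<close>, applied to the tangent vectors with
  components \<open>u\<close>, \<open>v\<close>; \<open>conn M c x u v\<close> is the vector with components
  \<open>\<Sum>i j. \<Gamma>\<^sup>k\<^sub>i\<^sub>j u\<^sup>i v\<^sup>j\<close>, where \<open>\<Gamma>\<close> are the Christoffel symbols of a linear connection.
\<close>

record ('p, 'v) manifold =
  space_of :: "'p topology"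
  charts :: "('p, 'v) chart set"
  met :: "('p, 'v) chart \<Rightarrow> 'v \<Rightarrow> 'v \<Rightarrow> 'v \<Rightarrow> real"
  conn :: "('p, 'v) chart \<Rightarrow> 'v \<Rightarrow> 'v \<Rightarrow> 'v \<Rightarrow> 'v"

definition coords :: "('p, 'v) chart \<Rightarrow> 'v set"
  where "coords c = snd c ` fst c"

definition local_rep :: "('p, 'v) chart \<Rightarrow> ('q, 'e) chart \<Rightarrow> ('p \<Rightarrow> 'q) \<Rightarrow> 'v \<Rightarrow> 'e"
  where "local_rep c d f = snd d \<circ> f \<circ> inv_into (fst c) (snd c)"

definition local_dom :: "('p, 'v) chart \<Rightarrow> ('q, 'e) chart \<Rightarrow> ('p \<Rightarrow> 'q) \<Rightarrow> 'v set"
  where "local_dom c d f = snd c ` (fst c \<inter> f -` fst d)"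

definition smooth_manifold :: "('p, 'v::euclidean_space) manifold \<Rightarrow> bool"
  where "smooth_manifold M \<longleftrightarrow>
    Hausdorff_space (space_of M) \<and>
    (\<exists>\<B>. countable \<B> \<and> (\<forall>V\<in>\<B>. openin (space_of M) V) \<and>
      (\<forall>U p. openin (space_of M) U \<and> p \<in> U \<longrightarrow> (\<exists>V\<in>\<B>. p \<in> V \<and> V \<subseteq> U))) \<and>
    \<Union> (fst ` charts M) = topspace (space_of M) \<and>
    (\<forall>c\<in>charts M. openin (space_of M) (fst c) \<and> open (coords c) \<and>
      homeomorphic_map (subtopology (space_of M) (fst c)) (top_of_set (coords c)) (snd c)) \<and>
    (\<forall>c\<in>charts M. \<forall>d\<in>charts M. smooth_on (local_dom c d id) (local_rep c d id))"


section \<open>Riemannian metrics and the Levi-Civita connection\<close>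

definition riemannian_metric :: "('p, 'v::euclidean_space) manifold \<Rightarrow> bool"
  where "riemannian_metric M \<longleftrightarrow>
    (\<forall>c\<in>charts M.
      (\<forall>x\<in>coords c. bilinear (met M c x) \<and> (\<forall>u v. met M c x u v = met M c x v u) \<and>
        (\<forall>u. u \<noteq> 0 \<longrightarrow> met M c x u u > 0)) \<and>
      (\<forall>u v. smooth_on (coords c) (\<lambda>x. met M c x u v))) \<and>
    (\<forall>c\<in>charts M. \<forall>d\<in>charts M. \<forall>x\<in>local_dom c d id. \<forall>u v.
      met M c x u v =
        met M d (local_rep c d id x) (D (local_rep c d id) x u) (D (local_rep c d id) x v))"

text \<open>
  Calculus with vector fields in one chart; \<open>\<Gamma>\<close> stands for \<open>conn M c\<close>, so that
  \<open>cov \<Gamma> X Y\<close> is \<open>\<nabla>\<^sub>X Y\<close> and \<open>curv \<Gamma> X Y Z\<close> is \<open>R(X,Y)Z\<close>.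
\<close>

definition lie :: "('v::euclidean_space \<Rightarrow> 'v) \<Rightarrow> ('v \<Rightarrow> 'v) \<Rightarrow> 'v \<Rightarrow> 'v"
  where "lie X Y x = D Y x (X x) - D X x (Y x)"

definition cov :: "('v::euclidean_space \<Rightarrow> 'v \<Rightarrow> 'v \<Rightarrow> 'v) \<Rightarrow> ('v \<Rightarrow> 'v) \<Rightarrow> ('v \<Rightarrow> 'v) \<Rightarrow> 'v \<Rightarrow> 'v"
  where "cov \<Gamma> X Y x = D Y x (X x) + \<Gamma> x (X x) (Y x)"

definition curv :: "('v::euclidean_space \<Rightarrow> 'v \<Rightarrow> 'v \<Rightarrow> 'v) \<Rightarrow>
    ('v \<Rightarrow> 'v) \<Rightarrow> ('v \<Rightarrow> 'v) \<Rightarrow> ('v \<Rightarrow> 'v) \<Rightarrow> 'v \<Rightarrow> 'v"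
  where "curv \<Gamma> X Y Z x =
    cov \<Gamma> X (cov \<Gamma> Y Z) x - cov \<Gamma> Y (cov \<Gamma> X Z) x - cov \<Gamma> (lie X Y) Z x"

text \<open>
  The value of the curvature tensor on tangent vectors at a point. Since the curvature is tensorial,
  the vectors may be extended to vector fields with constant components.
\<close>

definition curv_at :: "('v::euclidean_space \<Rightarrow> 'v \<Rightarrow> 'v \<Rightarrow> 'v) \<Rightarrow> 'v \<Rightarrow> 'v \<Rightarrow> 'v \<Rightarrow> 'v \<Rightarrow> 'v"
  where "curv_at \<Gamma> x u v w = curv \<Gamma> (\<lambda>_. u) (\<lambda>_. v) (\<lambda>_. w) x"

text \<open>
  \<open>conn M\<close> is torsion-free and compatible with the metric. These conditions determine it uniquely
  in each chart, so the transformation law of the Christoffel symbols under changes of charts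
  follows from that of the metric.
\<close>

definition levi_civita :: "('p, 'v::euclidean_space) manifold \<Rightarrow> bool"
  where "levi_civita M \<longleftrightarrow>
    (\<forall>c\<in>charts M.
      (\<forall>x\<in>coords c. bilinear (conn M c x)) \<and>
      (\<forall>u v. smooth_on (coords c) (\<lambda>x. conn M c x u v)) \<and>
      (\<forall>X Y. smooth_on (coords c) X \<and> smooth_on (coords c) Y \<longrightarrow>
        (\<forall>x\<in>coords c. cov (conn M c) X Y x - cov (conn M c) Y X x = lie X Y x)) \<and>
      (\<forall>X Y Z. smooth_on (coords c) X \<and> smooth_on (coords c) Y \<and> smooth_on (coords c) Z \<longrightarrow>
        (\<forall>x\<in>coords c. D (\<lambda>y. met M c y (Y y) (Z y)) x (X x) =
          met M c x (cov (conn M c) X Y x) (Z x) + met M c x (Y x) (cov (conn M c) X Z x))))"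

definition riemannian_manifold :: "('p, 'v::euclidean_space) manifold \<Rightarrow> bool"
  where "riemannian_manifold M \<longleftrightarrow> smooth_manifold M \<and> riemannian_metric M \<and> levi_civita M"

definition sectional_curvature ::
    "('v::euclidean_space \<Rightarrow> 'v \<Rightarrow> 'v \<Rightarrow> real) \<Rightarrow> ('v \<Rightarrow> 'v \<Rightarrow> 'v \<Rightarrow> 'v) \<Rightarrow> 'v \<Rightarrow> 'v \<Rightarrow> 'v \<Rightarrow> real"
  where "sectional_curvature g \<Gamma> x u v =
    g x (curv_at \<Gamma> x u v v) u / (g x u u * g x v v - (g x u v)\<^sup>2)"


section \<open>Complex space forms\<close>

text \<open>
  \<open>J c x\<close> is the almost complex structure at the point with coordinates \<open>x\<close> in the chart \<open>c\<close>;
  the last condition is \<open>\<nabla>J = 0\<close>.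
\<close>

definition kaehler_manifold ::
    "('q, 'e::euclidean_space) manifold \<Rightarrow> (('q, 'e) chart \<Rightarrow> 'e \<Rightarrow> 'e \<Rightarrow> 'e) \<Rightarrow> bool"
  where "kaehler_manifold N J \<longleftrightarrow> riemannian_manifold N \<and>
    (\<forall>c\<in>charts N.
      (\<forall>x\<in>coords c. linear (J c x) \<and> (\<forall>u. J c x (J c x u) = - u) \<and>
        (\<forall>u v. met N c x (J c x u) (J c x v) = met N c x u v)) \<and>
      (\<forall>u. smooth_on (coords c) (\<lambda>x. J c x u))) \<and>
    (\<forall>c\<in>charts N. \<forall>d\<in>charts N. \<forall>x\<in>local_dom c d id. \<forall>u.
      D (local_rep c d id) x (J c x u) = J d (local_rep c d id x) (D (local_rep c d id) x u)) \<and>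
    (\<forall>c\<in>charts N. \<forall>X Y. smooth_on (coords c) X \<and> smooth_on (coords c) Y \<longrightarrow>
      (\<forall>x\<in>coords c. cov (conn N c) X (\<lambda>y. J c y (Y y)) x = J c x (cov (conn N c) X Y x)))"

definition complex_space_form ::
    "('q, 'e::euclidean_space) manifold \<Rightarrow> (('q, 'e) chart \<Rightarrow> 'e \<Rightarrow> 'e \<Rightarrow> 'e) \<Rightarrow> real \<Rightarrow> bool"
  where "complex_space_form N J k \<longleftrightarrow> kaehler_manifold N J \<and>
    (\<forall>c\<in>charts N. \<forall>x\<in>coords c. \<forall>u. u \<noteq> 0 \<longrightarrow>
      sectional_curvature (met N c) (conn N c) x u (J c x u) = k)"


section \<open>Isometric and Lagrangian immersions\<close>

definition isometric_immersion ::
    "('p, 'v::euclidean_space) manifold \<Rightarrow> ('q, 'e::euclidean_space) manifold \<Rightarrow> ('p \<Rightarrow> 'q) \<Rightarrow> bool"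
  where "isometric_immersion M N \<phi> \<longleftrightarrow>
    continuous_map (space_of M) (space_of N) \<phi> \<and>
    (\<forall>c\<in>charts M. \<forall>d\<in>charts N.
      smooth_on (local_dom c d \<phi>) (local_rep c d \<phi>) \<and>
      (\<forall>x\<in>local_dom c d \<phi>. inj (D (local_rep c d \<phi>) x) \<and>
        (\<forall>u v. met M c x u v =
          met N d (local_rep c d \<phi> x) (D (local_rep c d \<phi>) x u) (D (local_rep c d \<phi>) x v))))"

text \<open>
  \<open>J (d\<phi> (T\<^sub>x M))\<close> is orthogonal to \<open>d\<phi> (T\<^sub>x M)\<close>, and the real dimension of \<open>M\<close> is the complex
  dimension of \<open>N\<close>.
\<close>

definition lagrangian ::
    "('p, 'v::euclidean_space) manifold \<Rightarrow> ('q, 'e::euclidean_space) manifold \<Rightarrow>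
      (('q, 'e) chart \<Rightarrow> 'e \<Rightarrow> 'e \<Rightarrow> 'e) \<Rightarrow> ('p \<Rightarrow> 'q) \<Rightarrow> bool"
  where "lagrangian M N J \<phi> \<longleftrightarrow> DIM('e) = 2 * DIM('v) \<and>
    (\<forall>c\<in>charts M. \<forall>d\<in>charts N. \<forall>x\<in>local_dom c d \<phi>. \<forall>u v.
      met N d (local_rep c d \<phi> x)
        (J d (local_rep c d \<phi> x) (D (local_rep c d \<phi>) x u)) (D (local_rep c d \<phi>) x v) = 0)"


section \<open>Submanifold geometry in charts\<close>

text \<open>
  In this section \<open>f\<close> is the local representation of an isometric immersion, \<open>\<Gamma>\<close> the connection of
  the submanifold, \<open>\<Gamma>'\<close> and \<open>h\<close> the connection and the metric of the ambient manifold, all in fixed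
  charts. Sections of the pulled-back tangent bundle of the ambient manifold are functions
  \<open>'v \<Rightarrow> 'e\<close>; \<open>pcov \<Gamma>' f X W\<close> is the derivative of the section \<open>W\<close> in the direction \<open>X\<close> with respect
  to the induced connection.
\<close>

definition dmap :: "('v::euclidean_space \<Rightarrow> 'e::euclidean_space) \<Rightarrow> ('v \<Rightarrow> 'v) \<Rightarrow> 'v \<Rightarrow> 'e"
  where "dmap f X x = D f x (X x)"

definition pcov :: "('e::euclidean_space \<Rightarrow> 'e \<Rightarrow> 'e \<Rightarrow> 'e) \<Rightarrow> ('v::euclidean_space \<Rightarrow> 'e) \<Rightarrow>
    ('v \<Rightarrow> 'v) \<Rightarrow> ('v \<Rightarrow> 'e) \<Rightarrow> 'v \<Rightarrow> 'e"
  where "pcov \<Gamma>' f X W x = D W x (X x) + \<Gamma>' (f x) (dmap f X x) (W x)"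

definition second_ff :: "('v::euclidean_space \<Rightarrow> 'v \<Rightarrow> 'v \<Rightarrow> 'v) \<Rightarrow>
    ('e::euclidean_space \<Rightarrow> 'e \<Rightarrow> 'e \<Rightarrow> 'e) \<Rightarrow> ('v \<Rightarrow> 'e) \<Rightarrow> ('v \<Rightarrow> 'v) \<Rightarrow> ('v \<Rightarrow> 'v) \<Rightarrow> 'v \<Rightarrow> 'e"
  where "second_ff \<Gamma> \<Gamma>' f X Y x = pcov \<Gamma>' f X (dmap f Y) x - dmap f (cov \<Gamma> X Y) x"

text \<open>\<open>tan_part h f W\<close> is the vector field on the submanifold whose image is the tangential part of \<open>W\<close>.\<close>

definition tan_part :: "('e::euclidean_space \<Rightarrow> 'e \<Rightarrow> 'e \<Rightarrow> real) \<Rightarrow> ('v::euclidean_space \<Rightarrow> 'e) \<Rightarrow>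
    ('v \<Rightarrow> 'e) \<Rightarrow> 'v \<Rightarrow> 'v"
  where "tan_part h f W x = (THE w. \<forall>u. h (f x) (W x - D f x w) (D f x u) = 0)"

text \<open>
  For a normal section \<open>\<xi>\<close>, the following are \<open>A\<^sub>\<xi> X\<close> and the normal derivative of \<open>\<xi>\<close> in the
  direction \<open>X\<close>, i.e. the two parts of \<open>pcov \<Gamma>' f X \<xi>\<close> in the Weingarten formula.
\<close>

definition shape :: "('e::euclidean_space \<Rightarrow> 'e \<Rightarrow> 'e \<Rightarrow> real) \<Rightarrow> ('e \<Rightarrow> 'e \<Rightarrow> 'e \<Rightarrow> 'e) \<Rightarrow>
    ('v::euclidean_space \<Rightarrow> 'e) \<Rightarrow> ('v \<Rightarrow> 'e) \<Rightarrow> ('v \<Rightarrow> 'v) \<Rightarrow> 'v \<Rightarrow> 'v"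
  where "shape h \<Gamma>' f \<xi> X x = - tan_part h f (pcov \<Gamma>' f X \<xi>) x"

definition ncov :: "('e::euclidean_space \<Rightarrow> 'e \<Rightarrow> 'e \<Rightarrow> real) \<Rightarrow> ('e \<Rightarrow> 'e \<Rightarrow> 'e \<Rightarrow> 'e) \<Rightarrow>
    ('v::euclidean_space \<Rightarrow> 'e) \<Rightarrow> ('v \<Rightarrow> 'v) \<Rightarrow> ('v \<Rightarrow> 'e) \<Rightarrow> 'v \<Rightarrow> 'e"
  where "ncov h \<Gamma>' f X \<xi> x =
    pcov \<Gamma>' f X \<xi> x - dmap f (tan_part h f (pcov \<Gamma>' f X \<xi>)) x"

text \<open>\<open>(\<nabla>\<^sub>X A\<^sub>\<xi>)(Y) = \<nabla>\<^sub>X (A\<^sub>\<xi> Y) - A\<^sub>\<xi> (\<nabla>\<^sub>X Y)\<close>\<close>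

definition cov_shape :: "('v::euclidean_space \<Rightarrow> 'v \<Rightarrow> 'v \<Rightarrow> 'v) \<Rightarrow>
    ('e::euclidean_space \<Rightarrow> 'e \<Rightarrow> 'e \<Rightarrow> real) \<Rightarrow> ('e \<Rightarrow> 'e \<Rightarrow> 'e \<Rightarrow> 'e) \<Rightarrow>
    ('v \<Rightarrow> 'e) \<Rightarrow> ('v \<Rightarrow> 'e) \<Rightarrow> ('v \<Rightarrow> 'v) \<Rightarrow> ('v \<Rightarrow> 'v) \<Rightarrow> 'v \<Rightarrow> 'v"
  where "cov_shape \<Gamma> h \<Gamma>' f \<xi> X Y x =
    cov \<Gamma> X (shape h \<Gamma>' f \<xi> Y) x - shape h \<Gamma>' f \<xi> (cov \<Gamma> X Y) x"

text \<open>In the following, \<open>e 0, \<dots>, e (DIM('v) - 1)\<close> is a local orthonormal frame.\<close>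

definition mean_curv :: "('v::euclidean_space \<Rightarrow> 'v \<Rightarrow> 'v \<Rightarrow> 'v) \<Rightarrow>
    ('e::euclidean_space \<Rightarrow> 'e \<Rightarrow> 'e \<Rightarrow> 'e) \<Rightarrow> ('v \<Rightarrow> 'e) \<Rightarrow> (nat \<Rightarrow> 'v \<Rightarrow> 'v) \<Rightarrow> 'v \<Rightarrow> 'e"
  where "mean_curv \<Gamma> \<Gamma>' f e x =
    (1 / real DIM('v)) *\<^sub>R (\<Sum>i<DIM('v). second_ff \<Gamma> \<Gamma>' f (e i) (e i) x)"

definition rough_laplacian :: "('v::euclidean_space \<Rightarrow> 'v \<Rightarrow> 'v \<Rightarrow> 'v) \<Rightarrow>
    ('e::euclidean_space \<Rightarrow> 'e \<Rightarrow> 'e \<Rightarrow> 'e) \<Rightarrow> ('v \<Rightarrow> 'e) \<Rightarrow> (nat \<Rightarrow> 'v \<Rightarrow> 'v) \<Rightarrow> ('v \<Rightarrow> 'e) \<Rightarrow> 'v \<Rightarrow> 'e"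
  where "rough_laplacian \<Gamma> \<Gamma>' f e W x =
    - (\<Sum>k<DIM('v). pcov \<Gamma>' f (e k) (pcov \<Gamma>' f (e k) W) x - pcov \<Gamma>' f (cov \<Gamma> (e k) (e k)) W x)"

definition normal_laplacian :: "('v::euclidean_space \<Rightarrow> 'v \<Rightarrow> 'v \<Rightarrow> 'v) \<Rightarrow>
    ('e::euclidean_space \<Rightarrow> 'e \<Rightarrow> 'e \<Rightarrow> real) \<Rightarrow> ('e \<Rightarrow> 'e \<Rightarrow> 'e \<Rightarrow> 'e) \<Rightarrow>
    ('v \<Rightarrow> 'e) \<Rightarrow> (nat \<Rightarrow> 'v \<Rightarrow> 'v) \<Rightarrow> ('v \<Rightarrow> 'e) \<Rightarrow> 'v \<Rightarrow> 'e"
  where "normal_laplacian \<Gamma> h \<Gamma>' f e \<xi> x =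
    - (\<Sum>i<DIM('v). ncov h \<Gamma>' f (e i) (ncov h \<Gamma>' f (e i) \<xi>) x
        - ncov h \<Gamma>' f (cov \<Gamma> (e i) (e i)) \<xi> x)"

definition orthonormal_frame ::
    "('p, 'v::euclidean_space) manifold \<Rightarrow> ('p, 'v) chart \<Rightarrow> 'v set \<Rightarrow> (nat \<Rightarrow> 'v \<Rightarrow> 'v) \<Rightarrow> bool"
  where "orthonormal_frame M c W e \<longleftrightarrow> open W \<and> W \<subseteq> coords c \<and>
    (\<forall>i<DIM('v). smooth_on W (e i)) \<and>
    (\<forall>x\<in>W. \<forall>i<DIM('v). \<forall>j<DIM('v). met M c x (e i x) (e j x) = (if i = j then 1 else 0))"

text \<open>
  An identity involving a local orthonormal frame holds on \<open>M\<close>: it is required for all pairs of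
  charts, all local orthonormal frames defined where both charts are, and all points. Such frames
  exist around every point by the Gram-Schmidt process.
\<close>

definition holds_on :: "('p, 'v::euclidean_space) manifold \<Rightarrow> ('q, 'e::euclidean_space) manifold \<Rightarrow>
    ('p \<Rightarrow> 'q) \<Rightarrow> (('p, 'v) chart \<Rightarrow> ('q, 'e) chart \<Rightarrow> (nat \<Rightarrow> 'v \<Rightarrow> 'v) \<Rightarrow> 'v \<Rightarrow> bool) \<Rightarrow> bool"
  where "holds_on M N \<phi> P \<longleftrightarrow>
    (\<forall>c\<in>charts M. \<forall>d\<in>charts N. \<forall>W e.
      orthonormal_frame M c W e \<and> W \<subseteq> local_dom c d \<phi> \<longrightarrow> (\<forall>x\<in>W. P c d e x))"

definition biharmonic :: "('p, 'v::euclidean_space) manifold \<Rightarrow> ('q, 'e::euclidean_space) manifold \<Rightarrow>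
    ('p \<Rightarrow> 'q) \<Rightarrow> bool"
  where "biharmonic M N \<phi> \<longleftrightarrow>
    holds_on M N \<phi> (\<lambda>c d e x.
      let \<Gamma> = conn M c; \<Gamma>' = conn N d; f = local_rep c d \<phi>; H = mean_curv \<Gamma> \<Gamma>' f e
      in rough_laplacian \<Gamma> \<Gamma>' f e H x
          - (\<Sum>i<DIM('v). curv_at \<Gamma>' (f x) (H x) (dmap f (e i) x) (dmap f (e i) x)) = 0)"

end

theory Submission
  imports Defs
begin

text \<open>
  Choose a chart of each manifold and an orthonormal frame \<open>e\<^sub>i\<close>. The Gauss and Weingarten formulas split
  the derivatives of \<open>H\<close> along the immersion into tangential and normal parts; applying them twice gives
  \<open>\<Delta>H = d\<phi>(\<Sum> (\<nabla>A\<^sub>H)(e\<^sub>i,e\<^sub>i) + \<Sum> A(\<nabla>\<^sup>\<bottom>H)(e\<^sub>i)) + (\<Delta>\<^sup>\<bottom>H + \<Sum> B(A\<^sub>H e\<^sub>i, e\<^sub>i))\<close> for the rough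
  Laplacian, which is lemma \<open>rough_laplacian_decomposition\<close>. The curvature term has only a normal part:
  \<open>H\<close> is normal to a Lagrangian submanifold, so it is a combination of the vectors \<open>J d\<phi>(e\<^sub>i)\<close>, and the
  curvature formula of a complex space form gives \<open>\<Sum> R(H, d\<phi> e\<^sub>i) d\<phi> e\<^sub>i = (m + 3) \<epsilon> H\<close>, where \<open>m\<close>
  comes from the real space form part of the curvature and \<open>3\<close> from the part containing \<open>J\<close> (lemma
  \<open>curvature_trace\<close>). Thus the biharmonic equation is the vanishing of a tangential plus a normal
  vector, that is, of both.

  The curvature formula itself has to be derived from constant holomorphic sectional curvature. The
  curvature tensor of a Kaehler manifold has the usual symmetries and commutes with \<open>J\<close>, and a tensor
  with these symmetries is determined by its holomorphic sectional curvatures, by polarisation (lemma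
  \<open>zero_holomorphic_curvature_imp_zero\<close>).

  All of this is calculus with Christoffel symbols, whose analytic input is the product rule for a
  field of bilinear maps and the symmetry of second derivatives. The latter accounts for the symmetry
  of \<open>B\<close>, the skewness of the curvature operator, and its commuting with \<open>J\<close>.
\<close>

section \<open>Calculus of smooth maps\<close>

lemma differentiable_transform_open:
  assumes "f differentiable (at x)" "open S" "x \<in> S" "\<And>y. y \<in> S \<Longrightarrow> f y = g y"
  shows "g differentiable (at x)"
  using assms has_derivative_transform_within_open unfolding differentiable_def by blast

lemma D_has_derivative: "f differentiable (at x) \<Longrightarrow> (f has_derivative D f x) (at x)"
  by (simp add: frechet_derivative_works)

lemma D_eqI: "(f has_derivative f') (at x) \<Longrightarrow> D f x = f'"
  by (rule frechet_derivative_at[symmetric])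

lemma Ck_on_cong:
  assumes "open S" "\<And>y. y \<in> S \<Longrightarrow> f y = g y" "Ck_on k S f"
  shows "Ck_on k S g"
  using assms(2,3)
proof (induction k arbitrary: f g)
  case 0
  then show ?case using continuous_on_cong[of S S f g] by auto
next
  case (Suc k)
  have eq: "D f y = D g y" if "y \<in> S" for y
    using frechet_derivative_transform_within_open[of f y S g] Suc.prems that assms(1) by auto
  have "Ck_on k S (\<lambda>y. D g y v)" for v
    by (rule Suc.IH[of "\<lambda>y. D f y v"]) (use Suc.prems eq in auto)
  then show ?case
    using Suc.prems differentiable_transform_open[OF _ assms(1), where f = f and g = g] by auto
qed

lemma Ck_on_imp_continuous_on: "Ck_on k S f \<Longrightarrow> continuous_on S f"
  by (cases k) (auto intro!: continuous_at_imp_continuous_on differentiable_imp_continuous_within)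

lemma Ck_on_Suc_imp: "Ck_on (Suc k) S f \<Longrightarrow> Ck_on k S f"
proof (induction k arbitrary: f)
  case 0
  then show ?case using Ck_on_imp_continuous_on[of "Suc 0"] by simp
next
  case (Suc k)
  then show ?case by (metis Ck_on.simps(2))
qed

lemma Ck_on_subset: "Ck_on k S f \<Longrightarrow> T \<subseteq> S \<Longrightarrow> Ck_on k T f"
  by (induction k arbitrary: f) (auto intro: continuous_on_subset)

lemma Ck_on_const: "Ck_on k S (\<lambda>_. c)"
  by (induction k arbitrary: c) auto

lemma Ck_on_add:
  assumes "open S" "Ck_on k S f" "Ck_on k S g"
  shows "Ck_on k S (\<lambda>x. f x + g x)"
  using assms(2,3)
proof (induction k arbitrary: f g)
  case 0
  then show ?case by (auto intro: continuous_on_add)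
next
  case (Suc k)
  have "D (\<lambda>x. f x + g x) y = (\<lambda>v. D f y v + D g y v)" if "y \<in> S" for y
    by (rule D_eqI) (use that Suc.prems in \<open>auto intro!: has_derivative_add D_has_derivative\<close>)
  moreover have "Ck_on k S (\<lambda>x. D f x v + D g x v)" for v
    using Suc by auto
  ultimately have "Ck_on k S (\<lambda>x. D (\<lambda>x. f x + g x) x v)" for v
    by (auto intro: Ck_on_cong[OF assms(1), of "\<lambda>x. D f x v + D g x v"])
  then show ?case using Suc.prems by auto
qed

lemma Ck_on_bounded_bilinear:
  assumes "open S" "bounded_bilinear b" "Ck_on k S f" "Ck_on k S g"
  shows "Ck_on k S (\<lambda>x. b (f x) (g x))"
  using assms(3,4)
proof (induction k arbitrary: f g)
  case 0
  then show ?case using bounded_bilinear.continuous_on[OF assms(2)] by auto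
next
  case (Suc k)
  have der: "((\<lambda>x. b (f x) (g x)) has_derivative (\<lambda>v. b (f y) (D g y v) + b (D f y v) (g y))) (at y)"
    if "y \<in> S" for y
    by (rule bounded_bilinear.FDERIV[OF assms(2)])
      (use that Suc.prems in \<open>auto intro!: D_has_derivative\<close>)
  have "Ck_on k S (\<lambda>x. b (f x) (D g x v) + b (D f x v) (g x))" for v
    using Suc.prems Suc.prems[THEN Ck_on_Suc_imp] by (intro Ck_on_add[OF assms(1)] Suc.IH) auto
  then have "Ck_on k S (\<lambda>x. D (\<lambda>x. b (f x) (g x)) x v)" for v
    by (rule Ck_on_cong[OF assms(1), rotated]) (use D_eqI[OF der] in auto)
  then show ?case using der by (auto simp: differentiable_def)
qed

lemma Ck_on_sum:
  assumes "open S" "\<And>i. i \<in> I \<Longrightarrow> Ck_on k S (f i)"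
  shows "Ck_on k S (\<lambda>x. \<Sum>i\<in>I. f i x)"
  using assms(2)
  by (induction I rule: infinite_finite_induct) (auto intro!: Ck_on_const Ck_on_add[OF assms(1)])

lemma linear_eq_sum_Basis:
  fixes L :: "'a::euclidean_space \<Rightarrow> 'b::real_vector"
  assumes "linear L"
  shows "L v = (\<Sum>b\<in>Basis. (v \<bullet> b) *\<^sub>R L b)"
proof -
  have "L v = L (\<Sum>b\<in>Basis. (v \<bullet> b) *\<^sub>R b)" by (simp add: euclidean_representation)
  also have "\<dots> = (\<Sum>b\<in>Basis. (v \<bullet> b) *\<^sub>R L b)"
    using assms by (simp add: linear_sum linear_scale)
  finally show ?thesis .
qed

text \<open>
  A field of linear maps is known through its values on constant vectors; the expansion of \<open>V\<close> in the
  basis reduces the claim to products with scalar functions.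
\<close>

lemma Ck_on_linear_field:
  fixes V :: "'a::real_normed_vector \<Rightarrow> 'b::euclidean_space"
  assumes "open S" "\<And>x. x \<in> S \<Longrightarrow> linear (L x)" "\<And>v. Ck_on k S (\<lambda>x. L x v)" "Ck_on k S V"
  shows "Ck_on k S (\<lambda>x. L x (V x))"
proof (rule Ck_on_cong[OF assms(1)])
  show "(\<Sum>b\<in>Basis. (V x \<bullet> b) *\<^sub>R L x b) = L x (V x)" if "x \<in> S" for x
    by (rule linear_eq_sum_Basis[OF assms(2)[OF that], symmetric])
  show "Ck_on k S (\<lambda>x. \<Sum>b\<in>Basis. (V x \<bullet> b) *\<^sub>R L x b)"
    by (intro Ck_on_sum Ck_on_bounded_bilinear[OF _ bounded_bilinear_scaleR]
        Ck_on_bounded_bilinear[OF _ bounded_bilinear_inner] Ck_on_const assms)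
qed

text \<open>
  By the chain rule, a derivative of the composition is the field of linear maps \<open>D g (f x)\<close> applied
  to \<open>D f x v\<close>. The coefficients of this field are again compositions with \<open>f\<close>, of lower order of
  differentiability, so the induction closes up.
\<close>

lemma Ck_on_compose:
  fixes f :: "'a::real_normed_vector \<Rightarrow> 'b::euclidean_space"
    and g :: "'b \<Rightarrow> 'c::real_normed_vector"
  assumes "open S" "f ` S \<subseteq> T" "Ck_on k S f" "Ck_on k T g"
  shows "Ck_on k S (\<lambda>x. g (f x))"
  using assms(2-4)
proof (induction k arbitrary: f g)
  case 0
  then show ?case by (auto intro: continuous_on_compose2)
next
  case (Suc k)
  have der: "((\<lambda>x. g (f x)) has_derivative (\<lambda>v. D g (f y) (D f y v))) (at y)" if "y \<in> S" for y
    using has_derivative_compose[of f "D f y" y UNIV g "D g (f y)"] that Suc.prems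
    by (auto intro!: D_has_derivative)
  have "Ck_on k S (\<lambda>x. D g (f x) (D f x v))" for v
  proof (rule Ck_on_linear_field[OF assms(1)])
    show "linear (D g (f x))" if "x \<in> S" for x
      using that Suc.prems by (auto intro!: linear_frechet_derivative)
    show "Ck_on k S (\<lambda>x. D g (f x) w)" for w
      using Suc.prems Ck_on_Suc_imp[OF Suc.prems(2)] by (intro Suc.IH) auto
    show "Ck_on k S (\<lambda>x. D f x v)" using Suc.prems by auto
  qed
  then have "Ck_on k S (\<lambda>x. D (\<lambda>x. g (f x)) x v)" for v
    by (rule Ck_on_cong[OF assms(1), rotated]) (use D_eqI[OF der] in auto)
  then show ?case using der by (auto simp: differentiable_def)
qed

lemma smooth_on_cong: "open S \<Longrightarrow> (\<And>y. y \<in> S \<Longrightarrow> f y = g y) \<Longrightarrow> smooth_on S f \<Longrightarrow> smooth_on S g"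
  unfolding smooth_on_def using Ck_on_cong by blast

lemma smooth_on_subset: "smooth_on S f \<Longrightarrow> T \<subseteq> S \<Longrightarrow> smooth_on T f"
  unfolding smooth_on_def using Ck_on_subset by blast

lemma smooth_on_differentiable: "smooth_on S f \<Longrightarrow> x \<in> S \<Longrightarrow> f differentiable (at x)"
  unfolding smooth_on_def by (metis Ck_on.simps(2))

lemma smooth_on_D: "smooth_on S f \<Longrightarrow> smooth_on S (\<lambda>x. D f x v)"
  unfolding smooth_on_def by (metis Ck_on.simps(2))

lemma smooth_on_const: "smooth_on S (\<lambda>_. c)"
  by (simp add: smooth_on_def Ck_on_const)

lemma smooth_on_add:
  "open S \<Longrightarrow> smooth_on S f \<Longrightarrow> smooth_on S g \<Longrightarrow> smooth_on S (\<lambda>x. f x + g x)"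
  by (simp add: smooth_on_def Ck_on_add)

lemma smooth_on_sum:
  "open S \<Longrightarrow> (\<And>i. i \<in> I \<Longrightarrow> smooth_on S (f i)) \<Longrightarrow> smooth_on S (\<lambda>x. \<Sum>i\<in>I. f i x)"
  by (simp add: smooth_on_def Ck_on_sum)

lemma smooth_on_scaleR:
  "open S \<Longrightarrow> smooth_on S f \<Longrightarrow> smooth_on S g \<Longrightarrow> smooth_on S (\<lambda>x. f x *\<^sub>R g x)"
  by (simp add: smooth_on_def Ck_on_bounded_bilinear[OF _ bounded_bilinear_scaleR])

lemma smooth_on_uminus: "open S \<Longrightarrow> smooth_on S f \<Longrightarrow> smooth_on S (\<lambda>x. - f x)"
  using smooth_on_scaleR[OF _ smooth_on_const, of S f "-1"] by simp

lemma smooth_on_diff: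
  "open S \<Longrightarrow> smooth_on S f \<Longrightarrow> smooth_on S g \<Longrightarrow> smooth_on S (\<lambda>x. f x - g x)"
  using smooth_on_add[OF _ _ smooth_on_uminus, of S f g] by simp

lemma smooth_on_compose:
  fixes f :: "'a::real_normed_vector \<Rightarrow> 'b::euclidean_space"
  assumes "open S" "f ` S \<subseteq> T" "smooth_on S f" "smooth_on T g"
  shows "smooth_on S (\<lambda>x. g (f x))"
  using assms by (simp add: smooth_on_def Ck_on_compose)

lemma smooth_on_linear_field:
  fixes V :: "'a::real_normed_vector \<Rightarrow> 'b::euclidean_space"
  assumes "open S" "\<And>x. x \<in> S \<Longrightarrow> linear (L x)" "\<And>v. smooth_on S (\<lambda>x. L x v)" "smooth_on S V"
  shows "smooth_on S (\<lambda>x. L x (V x))"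
  using assms by (simp add: smooth_on_def Ck_on_linear_field)

lemma smooth_on_bilinear_field:
  fixes V :: "'a::real_normed_vector \<Rightarrow> 'b::euclidean_space"
    and U :: "'a \<Rightarrow> 'c::euclidean_space"
  assumes "open S" "\<And>x. x \<in> S \<Longrightarrow> bilinear (b x)" "\<And>u v. smooth_on S (\<lambda>x. b x u v)"
    "smooth_on S U" "smooth_on S V"
  shows "smooth_on S (\<lambda>x. b x (U x) (V x))"
proof (rule smooth_on_linear_field[OF assms(1) _ _ assms(5)])
  show "linear (b x (U x))" if "x \<in> S" for x using assms(2)[OF that] by (simp add: bilinear_def)
  show "smooth_on S (\<lambda>x. b x (U x) v)" for v
    by (rule smooth_on_linear_field[OF assms(1) _ _ assms(4)])
      (use assms(2,3) in \<open>auto simp: bilinear_def\<close>)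
qed

text \<open>
  The product rule for \<open>L y (V y)\<close>, where the dependence of \<open>L\<close> on \<open>y\<close> is differentiated at the frozen
  argument \<open>V x\<close>. It follows by expanding \<open>V y\<close> in a basis.
\<close>

lemma has_derivative_linear_field:
  fixes V :: "'a::real_normed_vector \<Rightarrow> 'b::euclidean_space"
  assumes "open S" "x \<in> S" "\<And>y. y \<in> S \<Longrightarrow> linear (L y)" "\<And>v. (\<lambda>y. L y v) differentiable (at x)"
    "V differentiable (at x)"
  shows "((\<lambda>y. L y (V y)) has_derivative (\<lambda>t. D (\<lambda>y. L y (V x)) x t + L x (D V x t))) (at x)"
proof -
  have d: "((\<lambda>y. L y v) has_derivative D (\<lambda>y. L y v) x) (at x)" for v
    using assms(4) by (rule D_has_derivative)
  have dV: "(V has_derivative D V x) (at x)"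
    using assms(5) by (rule D_has_derivative)
  have sum_eq: "L y v = (\<Sum>b\<in>Basis. (v \<bullet> b) *\<^sub>R L y b)" if "y \<in> S" for y v
    using linear_eq_sum_Basis[OF assms(3)[OF that]] .
  have "((\<lambda>y. \<Sum>b\<in>Basis. (V x \<bullet> b) *\<^sub>R L y b) has_derivative
      (\<lambda>t. \<Sum>b\<in>Basis. (V x \<bullet> b) *\<^sub>R D (\<lambda>y. L y b) x t)) (at x)"
    by (intro has_derivative_sum has_derivative_scaleR_right d)
  then have "((\<lambda>y. L y (V x)) has_derivative
      (\<lambda>t. \<Sum>b\<in>Basis. (V x \<bullet> b) *\<^sub>R D (\<lambda>y. L y b) x t)) (at x)"
    by (rule has_derivative_transform_within_open[OF _ assms(1,2)]) (rule sum_eq[symmetric])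
  then have D1: "D (\<lambda>y. L y (V x)) x t = (\<Sum>b\<in>Basis. (V x \<bullet> b) *\<^sub>R D (\<lambda>y. L y b) x t)" for t
    by (simp add: D_eqI)
  have "((\<lambda>y. \<Sum>b\<in>Basis. (V y \<bullet> b) *\<^sub>R L y b) has_derivative
      (\<lambda>t. \<Sum>b\<in>Basis. (V x \<bullet> b) *\<^sub>R D (\<lambda>y. L y b) x t + (D V x t \<bullet> b) *\<^sub>R L x b)) (at x)"
    by (intro has_derivative_sum has_derivative_scaleR d has_derivative_inner_left dV)
  then have "((\<lambda>y. \<Sum>b\<in>Basis. (V y \<bullet> b) *\<^sub>R L y b) has_derivative
      (\<lambda>t. D (\<lambda>y. L y (V x)) x t + L x (D V x t))) (at x)"
    unfolding sum.distrib D1[symmetric] sum_eq[OF assms(2), symmetric] .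
  then show ?thesis
    by (rule has_derivative_transform_within_open[OF _ assms(1,2)]) (rule sum_eq[symmetric])
qed

lemma has_derivative_bilinear_field:
  fixes U :: "'a::real_normed_vector \<Rightarrow> 'b::euclidean_space"
    and V :: "'a \<Rightarrow> 'c::euclidean_space"
  assumes "open S" "x \<in> S" "\<And>y. y \<in> S \<Longrightarrow> bilinear (b y)"
    "\<And>u v. (\<lambda>y. b y u v) differentiable (at x)"
    "U differentiable (at x)" "V differentiable (at x)"
  shows "((\<lambda>y. b y (U y) (V y)) has_derivative
    (\<lambda>t. D (\<lambda>y. b y (U x) (V x)) x t + b x (D U x t) (V x) + b x (U x) (D V x t))) (at x)"
proof -
  have 1: "((\<lambda>y. b y (U y) v) has_derivative (\<lambda>t. D (\<lambda>y. b y (U x) v) x t + b x (D U x t) v)) (at x)"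
    for v
    by (rule has_derivative_linear_field[OF assms(1,2) _ _ assms(5)])
      (use assms(3,4) in \<open>auto simp: bilinear_def\<close>)
  have "((\<lambda>y. b y (U y) (V y)) has_derivative
    (\<lambda>t. D (\<lambda>y. b y (U y) (V x)) x t + b x (U x) (D V x t))) (at x)"
  proof (rule has_derivative_linear_field[OF assms(1,2) _ _ assms(6)])
    show "linear (b y (U y))" if "y \<in> S" for y using assms(3)[OF that] by (simp add: bilinear_def)
    show "(\<lambda>y. b y (U y) v) differentiable (at x)" for v using 1 by (auto simp: differentiable_def)
  qed
  then show ?thesis by (simp add: D_eqI[OF 1])
qed

text \<open>
  The second difference of \<open>f\<close> over the parallelogram spanned by \<open>r u\<close> and \<open>r v\<close> is computed by the mean
  value theorem, first for \<open>f(\<cdot> + r v) - f\<close> along \<open>u\<close> and then for \<open>D f \<cdot> u\<close> along \<open>v\<close>.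
\<close>

lemma second_difference_mean_value:
  fixes f :: "'a::real_normed_vector \<Rightarrow> real"
  assumes r: "r > 0"
    and in_S: "\<And>s t. 0 \<le> s \<Longrightarrow> s \<le> r \<Longrightarrow> 0 \<le> t \<Longrightarrow> t \<le> r \<Longrightarrow> x + s *\<^sub>R u + t *\<^sub>R v \<in> S"
    and diff: "\<And>y. y \<in> S \<Longrightarrow> f differentiable (at y)"
    and diff2: "\<And>y. y \<in> S \<Longrightarrow> (\<lambda>y. D f y u) differentiable (at y)"
  obtains s t where "0 \<le> s" "s \<le> r" "0 \<le> t" "t \<le> r"
    "f (x + r *\<^sub>R u + r *\<^sub>R v) - f (x + r *\<^sub>R u) - f (x + r *\<^sub>R v) + f x =
      r * r * D (\<lambda>y. D f y u) (x + s *\<^sub>R u + t *\<^sub>R v) v"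
proof -
  define p where "p s t = x + s *\<^sub>R u + t *\<^sub>R v" for s t
  have pS: "p s t \<in> S" if "0 \<le> s" "s \<le> r" "0 \<le> t" "t \<le> r" for s t
    unfolding p_def by (rule in_S[OF that])
  have lin: "linear (D f y)" "linear (D (\<lambda>y. D f y u) y)" if "y \<in> S" for y
    using diff diff2 that by (auto intro!: linear_frechet_derivative)
  have ds: "((\<lambda>s. f (p s t)) has_derivative (\<lambda>d. d * D f (p s t) u)) (at s within {0..r})"
    if "0 \<le> s" "s \<le> r" "0 \<le> t" "t \<le> r" for s t
  proof -
    have "((\<lambda>s. p s t) has_derivative (\<lambda>d. d *\<^sub>R u)) (at s within {0..r})"
      unfolding p_def by (auto intro!: derivative_eq_intros)
    from has_derivative_compose[OF this D_has_derivative[OF diff[OF pS[OF that]]]]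
    show ?thesis by (simp add: linear_scale[OF lin(1)[OF pS[OF that]]])
  qed
  have dt: "((\<lambda>t. D f (p s t) u) has_derivative (\<lambda>d. d * D (\<lambda>y. D f y u) (p s t) v)) (at t within {0..r})"
    if "0 \<le> s" "s \<le> r" "0 \<le> t" "t \<le> r" for s t
  proof -
    have "((\<lambda>t. p s t) has_derivative (\<lambda>d. d *\<^sub>R v)) (at t within {0..r})"
      unfolding p_def by (auto intro!: derivative_eq_intros)
    from has_derivative_compose[OF this D_has_derivative[OF diff2[OF pS[OF that]]]]
    show ?thesis by (simp add: linear_scale[OF lin(2)[OF pS[OF that]]])
  qed
  have "\<exists>s\<in>{0<..<r}. (f (p r r) - f (p r 0)) - (f (p 0 r) - f (p 0 0)) =
      (r - 0) * D f (p s r) u - (r - 0) * D f (p s 0) u"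
    by (rule mvt_simple[OF r]) (use r in \<open>auto intro!: has_derivative_diff ds\<close>)
  then obtain s where s: "0 < s" "s < r"
    and eq1: "f (p r r) - f (p r 0) - (f (p 0 r) - f (p 0 0)) = r * (D f (p s r) u - D f (p s 0) u)"
    by (auto simp: algebra_simps)
  have "\<exists>t\<in>{0<..<r}. D f (p s r) u - D f (p s 0) u = (r - 0) * D (\<lambda>y. D f y u) (p s t) v"
    by (rule mvt_simple[OF r]) (use s in \<open>auto intro!: dt\<close>)
  then obtain t where t: "0 < t" "t < r"
    and eq2: "D f (p s r) u - D f (p s 0) u = r * D (\<lambda>y. D f y u) (p s t) v"
    by auto
  show ?thesis
    by (rule that[of s t]) (use s t eq1 eq2 in \<open>auto simp: p_def algebra_simps\<close>)
qed

text \<open>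
  The second difference is symmetric in \<open>u\<close> and \<open>v\<close>. Hence, arbitrarily close to \<open>x\<close>, one mixed
  derivative at some point equals the other one at some other point, and both are continuous.
\<close>

lemma symmetric_second_derivative_real:
  fixes f :: "'a::real_normed_vector \<Rightarrow> real"
  assumes "open S" "x \<in> S" and f: "Ck_on 2 S f"
  shows "D (\<lambda>y. D f y u) x v = D (\<lambda>y. D f y v) x u"
proof (rule ccontr)
  assume neq: "D (\<lambda>y. D f y u) x v \<noteq> D (\<lambda>y. D f y v) x u"
  define F where "F = (\<lambda>u v y. D (\<lambda>y. D f y u) y v)"
  define e where "e = \<bar>F u v x - F v u x\<bar> / 2"
  have e: "e > 0" using neq by (simp add: e_def F_def)
  have f1: "f differentiable (at y)" "(\<lambda>y. D f y w) differentiable (at y)"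
    "continuous_on S (F w w')" if "y \<in> S" for y w w'
    using f that by (auto simp: numeral_2_eq_2 F_def)
  have "\<exists>d>0. \<forall>y. dist y x < d \<longrightarrow> \<bar>F w w' y - F w w' x\<bar> < e" for w w'
  proof -
    have "isCont (F w w') x"
      using f1(3)[OF assms(2)] assms(1,2) by (simp add: continuous_on_eq_continuous_at)
    then show ?thesis using e by (simp add: continuous_at_eps_delta dist_real_def)
  qed
  then obtain d1 d2 where d: "d1 > 0" "d2 > 0"
    "\<And>y. dist y x < d1 \<Longrightarrow> \<bar>F u v y - F u v x\<bar> < e"
    "\<And>y. dist y x < d2 \<Longrightarrow> \<bar>F v u y - F v u x\<bar> < e" by metis
  obtain d3 where d3: "d3 > 0" "ball x d3 \<subseteq> S"
    using assms open_contains_ball by blast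
  define \<delta> where "\<delta> = min d1 (min d2 d3)"
  define r where "r = \<delta> / (2 * (norm u + norm v + 1))"
  have \<delta>: "\<delta> > 0" using d d3 by (simp add: \<delta>_def)
  have pos: "norm u + norm v + 1 > 0" by (smt (verit) norm_ge_zero)
  then have r: "r > 0" using \<delta> by (simp add: r_def)
  have near: "dist (x + s *\<^sub>R u + t *\<^sub>R v) x < \<delta>" if "0 \<le> s" "s \<le> r" "0 \<le> t" "t \<le> r" for s t
  proof -
    have "dist (x + s *\<^sub>R u + t *\<^sub>R v) x \<le> s * norm u + t * norm v"
      using that norm_triangle_ineq[of "s *\<^sub>R u" "t *\<^sub>R v"] by (simp add: dist_norm)
    also have "\<dots> \<le> r * (norm u + norm v + 1)"
      using that r mult_right_mono[of s r "norm u"] mult_right_mono[of t r "norm v"]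
      by (simp add: distrib_left)
    also have "\<dots> = \<delta> / 2" using pos by (simp add: r_def divide_simps)
    also have "\<dots> < \<delta>" using \<delta> by simp
    finally show ?thesis .
  qed
  then have near': "x + s *\<^sub>R u + t *\<^sub>R v \<in> S" if "0 \<le> s" "s \<le> r" "0 \<le> t" "t \<le> r" for s t
    using that d3 by (force simp: \<delta>_def dist_commute)
  have near'': "x + s *\<^sub>R v + t *\<^sub>R u \<in> S" if "0 \<le> s" "s \<le> r" "0 \<le> t" "t \<le> r" for s t
    using near'[OF that(3,4,1,2)] by (simp add: add_ac)
  obtain s t where st: "0 \<le> s" "s \<le> r" "0 \<le> t" "t \<le> r"
    "f (x + r *\<^sub>R u + r *\<^sub>R v) - f (x + r *\<^sub>R u) - f (x + r *\<^sub>R v) + f x =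
      r * r * F u v (x + s *\<^sub>R u + t *\<^sub>R v)"
    unfolding F_def by (rule second_difference_mean_value[OF r, of x u v S f]) (use near' f1 in auto)
  obtain s' t' where st': "0 \<le> s'" "s' \<le> r" "0 \<le> t'" "t' \<le> r"
    "f (x + r *\<^sub>R v + r *\<^sub>R u) - f (x + r *\<^sub>R v) - f (x + r *\<^sub>R u) + f x =
      r * r * F v u (x + s' *\<^sub>R v + t' *\<^sub>R u)"
    unfolding F_def by (rule second_difference_mean_value[OF r, of x v u S f])
      (use near'' f1 in auto)
  have "r * r * F u v (x + s *\<^sub>R u + t *\<^sub>R v) = r * r * F v u (x + t' *\<^sub>R u + s' *\<^sub>R v)"
  proof -
    have swap: "x + r *\<^sub>R v + r *\<^sub>R u = x + r *\<^sub>R u + r *\<^sub>R v"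
      "x + s' *\<^sub>R v + t' *\<^sub>R u = x + t' *\<^sub>R u + s' *\<^sub>R v" by simp_all
    show ?thesis using st(5) st'(5)[unfolded swap] by linarith
  qed
  then have "F u v (x + s *\<^sub>R u + t *\<^sub>R v) = F v u (x + t' *\<^sub>R u + s' *\<^sub>R v)"
    using r by simp
  moreover have "\<bar>F u v (x + s *\<^sub>R u + t *\<^sub>R v) - F u v x\<bar> < e"
    "\<bar>F v u (x + t' *\<^sub>R u + s' *\<^sub>R v) - F v u x\<bar> < e"
    using d near[OF st(1-4)] near[OF st'(3,4,1,2)] by (auto simp: \<delta>_def)
  ultimately show False unfolding e_def by (smt (verit) field_sum_of_halves)
qed

lemma symmetric_second_derivative:
  fixes f :: "'a::real_normed_vector \<Rightarrow> 'b::euclidean_space"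
  assumes "open S" "x \<in> S" and f: "smooth_on S f"
  shows "D (\<lambda>y. D f y u) x v = D (\<lambda>y. D f y v) x u"
proof (rule euclidean_eqI)
  fix b :: 'b assume "b \<in> Basis"
  let ?g = "\<lambda>y. f y \<bullet> b"
  have D1: "D ?g y w = D f y w \<bullet> b" if "y \<in> S" for y w
    using D_eqI[OF has_derivative_inner_left[OF D_has_derivative[OF smooth_on_differentiable[OF f that]]]]
    by metis
  have D2: "D (\<lambda>y. D ?g y w) x w' = D (\<lambda>y. D f y w) x w' \<bullet> b" for w w'
  proof -
    have "((\<lambda>y. D f y w \<bullet> b) has_derivative (\<lambda>t. D (\<lambda>y. D f y w) x t \<bullet> b)) (at x)"
      by (intro has_derivative_inner_left D_has_derivative
          smooth_on_differentiable[OF smooth_on_D[OF f] assms(2)])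
    then have "((\<lambda>y. D ?g y w) has_derivative (\<lambda>t. D (\<lambda>y. D f y w) x t \<bullet> b)) (at x)"
      by (rule has_derivative_transform_within_open[OF _ assms(1,2)]) (simp add: D1)
    then show ?thesis using D_eqI by metis
  qed
  have "Ck_on 2 S ?g"
    using f by (intro Ck_on_bounded_bilinear[OF _ bounded_bilinear_inner] Ck_on_const assms)
      (simp add: smooth_on_def)
  from symmetric_second_derivative_real[OF assms(1,2) this, of u v]
  show "D (\<lambda>y. D f y u) x v \<bullet> b = D (\<lambda>y. D f y v) x u \<bullet> b" by (simp add: D2)
qed

section \<open>Algebraic curvature tensors\<close>

text \<open>
  Linearity in the first argument suffices as an axiom: the symmetries carry it to the other three.
\<close>

locale curvature_like =
  fixes T :: "'a::real_vector \<Rightarrow> 'a \<Rightarrow> 'a \<Rightarrow> 'a \<Rightarrow> real"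
  assumes linear_first: "linear (\<lambda>u. T u v w z)"
    and antisym_first: "T u v w z = - T v u w z"
    and antisym_last: "T u v w z = - T u v z w"
    and bianchi: "T u v w z + T v w u z + T w u v z = 0"
begin

lemma pair_symmetry: "T u v w z = T w z u v"
  using bianchi[of u v w z] bianchi[of v w z u] bianchi[of w z u v] bianchi[of z u v w]
    antisym_last[of v w u z] antisym_last[of w u v z] antisym_last[of u v w z]
    antisym_last[of w z u v] antisym_last[of z u v w] antisym_first[of u w z v]
    antisym_first[of z v w u] antisym_last[of w u z v] antisym_first[of v z u w]
    antisym_last[of v z u w]
  by linarith

lemma additive [simp]:
  "T (u + u') v w z = T u v w z + T u' v w z"
  "T u (v + v') w z = T u v w z + T u v' w z"
  "T u v (w + w') z = T u v w z + T u v w' z"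
  "T u v w (z + z') = T u v w z + T u v w z'"
proof -
  have 1: "T (u + u') v w z = T u v w z + T u' v w z" for u u' v w z
    using linear_add[OF linear_first] .
  have 2: "T u (v + v') w z = T u v w z + T u v' w z" for u v v' w z
    using 1[of v v' u w z] antisym_first by (metis minus_add_distrib)
  show "T (u + u') v w z = T u v w z + T u' v w z" "T u (v + v') w z = T u v w z + T u v' w z"
    by (fact 1 2)+
  show "T u v (w + w') z = T u v w z + T u v w' z" "T u v w (z + z') = T u v w z + T u v w z'"
    using 1 2 pair_symmetry by metis+
qed

lemma minus [simp]:
  "T (- u) v w z = - T u v w z"
  "T u (- v) w z = - T u v w z"
  "T u v (- w) z = - T u v w z"
  "T u v w (- z) = - T u v w z"
proof -
  have 0: "T 0 v w z = 0" "T u 0 w z = 0" "T u v 0 z = 0" "T u v w 0 = 0" for u v w z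
    using additive(1)[of 0 0 v w z] additive(2)[of u 0 0 w z] additive(3)[of u v 0 0 z]
      additive(4)[of u v w 0 0] by simp_all
  show "T (- u) v w z = - T u v w z" using additive(1)[of u "- u" v w z] 0
    by (simp add: eq_neg_iff_add_eq_0 add.commute)
  show "T u (- v) w z = - T u v w z" using additive(2)[of u v "- v" w z] 0
    by (simp add: eq_neg_iff_add_eq_0 add.commute)
  show "T u v (- w) z = - T u v w z" using additive(3)[of u v w "- w" z] 0
    by (simp add: eq_neg_iff_add_eq_0 add.commute)
  show "T u v w (- z) = - T u v w z" using additive(4)[of u v w z "- z"] 0
    by (simp add: eq_neg_iff_add_eq_0 add.commute)
qed

lemma diff [simp]:
  "T (u - u') v w z = T u v w z - T u' v w z"
  "T u (v - v') w z = T u v w z - T u v' w z"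
  "T u v (w - w') z = T u v w z - T u v w' z"
  "T u v w (z - z') = T u v w z - T u v w z'"
  by (simp_all only: diff_conv_add_uminus additive minus)

end

locale kaehler_curvature_like = curvature_like T
  for T :: "'a::real_vector \<Rightarrow> 'a \<Rightarrow> 'a \<Rightarrow> 'a \<Rightarrow> real" +
  fixes J :: "'a \<Rightarrow> 'a"
  assumes J_linear: "linear J"
    and J_J [simp]: "J (J u) = - u"
    and J_invariant: "T u v (J w) (J z) = T u v w z"
begin

lemma J_add [simp]: "J (u + v) = J u + J v"
  using J_linear by (rule linear_add)

lemma J_minus [simp]: "J (- u) = - J u"
  using J_linear by (rule linear_neg)

lemma J_diff [simp]: "J (u - v) = J u - J v"
  using J_linear by (rule linear_diff)

text \<open>
  Polarising \<open>T(u,Ju,Ju,u) = 0\<close> gives, after reducing all six mixed terms with the symmetries of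
  \<open>T\<close>, that \<open>K(u,v) + 3 K(u,Jv) = 0\<close> for \<open>K(u,v) = T(u,v,v,u)\<close>. Replacing \<open>v\<close> by \<open>Jv\<close> gives
  \<open>K(u,Jv) + 3 K(u,v) = 0\<close>, so \<open>K = 0\<close>; polarising once more in \<open>u\<close> gives the claim.
\<close>

lemma zero_holomorphic_curvature_imp_zero:
  assumes Q: "\<And>u. T u (J u) (J u) u = 0"
  shows "T u v v z = 0"
proof -
  have J_first: "T (J u) (J v) w z = T u v w z" for u v w z
    using pair_symmetry J_invariant by metis
  have K: "T u v v u + 3 * T u (J v) (J v) u = 0" for u v
  proof -
    \<comment> \<open>The part of \<open>T(u,Ju,Ju,u)\<close> at \<open>u + v\<close> that is quadratic in \<open>u\<close> and in \<open>v\<close>.\<close>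
    have "T u (J u) (J v) v + T v (J v) (J u) u + T u (J v) (J u) v + T v (J u) (J v) u
        + T u (J v) (J v) u + T v (J u) (J u) v = 0"
      using Q[of "u + v"] Q[of "u - v"] Q[of u] Q[of v]
      by (simp add: algebra_simps)
    moreover have "T v (J v) (J u) u = T u (J u) (J v) v"
      using pair_symmetry[of v "J v" "J u" u] antisym_first[of "J u" u v "J v"]
        antisym_last[of u "J u" v "J v"] by simp
    moreover have "T v (J u) (J u) v = T u (J v) (J v) u"
      using J_first[of v "J u" "J u" v] J_invariant[of "J v" "- u" "J u" v]
        antisym_first[of "J v" u u "J v"] antisym_last[of u "J v" u "J v"] by simp
    moreover have "T u (J v) (J u) v = T v (J u) (J u) v"
      using J_first[of u "J v" "J u" v] antisym_first[of "J u" v "J u" v] by simp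
    moreover have "T v (J u) (J v) u = T u (J v) (J v) u"
      using J_first[of v "J u" "J v" u] antisym_first[of "J v" u "J v" u] by simp
    moreover have "T u (J u) (J v) v = T u v v u + T u (J v) (J v) u"
    proof -
      have "T (J u) (J v) u v = - T u v v u"
        using J_first[of u v u v] antisym_last[of u v u v] by simp
      moreover have "T (J v) u (J u) v = - T u (J v) (J v) u"
        using antisym_first[of "J v" u "J u" v] calculation
          \<open>T v (J u) (J u) v = T u (J v) (J v) u\<close> \<open>T u (J v) (J u) v = T v (J u) (J u) v\<close> by simp
      ultimately show ?thesis using bianchi[of u "J u" "J v" v] by simp
    qed
    ultimately show ?thesis by simp
  qed
  have zero: "T u v v u = 0" for u v
    using K[of u v] K[of u "J v"] by simp
  have "T u v v z + T z v v u = 0"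
    using zero[of "u + z" v] zero[of u v] zero[of z v] by simp
  moreover have "T z v v u = T u v v z"
    using pair_symmetry[of z v v u] antisym_first[of v u z v] antisym_last[of u v z v] by simp
  ultimately show ?thesis by simp
qed

end


section \<open>The Levi-Civita connection in a chart\<close>

text \<open>
  Torsion-freeness and metric compatibility enter only through the Christoffel symbols, that is,
  for coordinate vector fields. Other fields are reduced to these by the product rule.
\<close>

locale levi_civita_chart =
  fixes S :: "'v::euclidean_space set"
    and g :: "'v \<Rightarrow> 'v \<Rightarrow> 'v \<Rightarrow> real"
    and \<Gamma> :: "'v \<Rightarrow> 'v \<Rightarrow> 'v \<Rightarrow> 'v"
  assumes open_S: "open S"
    and met_bilinear: "x \<in> S \<Longrightarrow> bilinear (g x)"
    and met_sym: "x \<in> S \<Longrightarrow> g x u v = g x v u"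
    and met_pos: "x \<in> S \<Longrightarrow> u \<noteq> 0 \<Longrightarrow> g x u u > 0"
    and met_smooth: "smooth_on S (\<lambda>x. g x u v)"
    and conn_bilinear: "x \<in> S \<Longrightarrow> bilinear (\<Gamma> x)"
    and conn_smooth: "smooth_on S (\<lambda>x. \<Gamma> x u v)"
    and conn_sym: "x \<in> S \<Longrightarrow> \<Gamma> x u v = \<Gamma> x v u"
    and conn_met: "x \<in> S \<Longrightarrow> D (\<lambda>y. g y v w) x u = g x (\<Gamma> x u v) w + g x v (\<Gamma> x u w)"
begin

lemmas met_simps =
  bilinear_ladd[OF met_bilinear] bilinear_radd[OF met_bilinear]
  bilinear_lmul[OF met_bilinear] bilinear_rmul[OF met_bilinear]
  bilinear_lneg[OF met_bilinear] bilinear_rneg[OF met_bilinear]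
  bilinear_lsub[OF met_bilinear] bilinear_rsub[OF met_bilinear]
  bilinear_lzero[OF met_bilinear] bilinear_rzero[OF met_bilinear]

lemmas conn_simps =
  bilinear_ladd[OF conn_bilinear] bilinear_radd[OF conn_bilinear]
  bilinear_lmul[OF conn_bilinear] bilinear_rmul[OF conn_bilinear]
  bilinear_lneg[OF conn_bilinear] bilinear_rneg[OF conn_bilinear]
  bilinear_lsub[OF conn_bilinear] bilinear_rsub[OF conn_bilinear]
  bilinear_lzero[OF conn_bilinear] bilinear_rzero[OF conn_bilinear]

lemma met_nondegenerate:
  assumes "x \<in> S" "\<And>z. g x u z = g x v z"
  shows "u = v"
proof (rule ccontr)
  assume "u \<noteq> v"
  then have "g x (u - v) (u - v) > 0" using met_pos assms(1) by simp
  then show False using assms by (simp add: met_simps)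
qed

lemma conn_differentiable: "x \<in> S \<Longrightarrow> (\<lambda>y. \<Gamma> y u v) differentiable (at x)"
  using smooth_on_differentiable[OF conn_smooth] .

lemma met_differentiable: "x \<in> S \<Longrightarrow> (\<lambda>y. g y u v) differentiable (at x)"
  using smooth_on_differentiable[OF met_smooth] .

lemma curv_at_eq:
  assumes "x \<in> S"
  shows "curv_at \<Gamma> x u v w =
    D (\<lambda>y. \<Gamma> y v w) x u + \<Gamma> x u (\<Gamma> x v w) - D (\<lambda>y. \<Gamma> y u w) x v - \<Gamma> x v (\<Gamma> x u w)"
proof -
  have "cov \<Gamma> (\<lambda>_. v) (\<lambda>_. w) = (\<lambda>y. \<Gamma> y v w)" for v w
    by (rule ext) (simp add: cov_def)
  then show ?thesis
    using assms by (simp add: curv_at_def curv_def lie_def conn_simps) (simp add: cov_def lie_def conn_simps)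
qed

lemma curv_at_antisym: "x \<in> S \<Longrightarrow> curv_at \<Gamma> x u v w = - curv_at \<Gamma> x v u w"
  by (simp add: curv_at_eq)

lemma D_conn_swap:
  assumes "x \<in> S"
  shows "D (\<lambda>y. \<Gamma> y u v) x = D (\<lambda>y. \<Gamma> y v u) x"
  using frechet_derivative_transform_within_open[OF conn_differentiable[OF assms] open_S assms conn_sym] .

lemma D_conn_add:
  assumes "x \<in> S"
  shows "D (\<lambda>y. \<Gamma> y (u + u') v) x t = D (\<lambda>y. \<Gamma> y u v) x t + D (\<lambda>y. \<Gamma> y u' v) x t"
proof -
  have "((\<lambda>y. \<Gamma> y u v + \<Gamma> y u' v) has_derivative
      (\<lambda>t. D (\<lambda>y. \<Gamma> y u v) x t + D (\<lambda>y. \<Gamma> y u' v) x t)) (at x)"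
    by (intro has_derivative_add D_has_derivative conn_differentiable assms)
  then have "((\<lambda>y. \<Gamma> y (u + u') v) has_derivative
      (\<lambda>t. D (\<lambda>y. \<Gamma> y u v) x t + D (\<lambda>y. \<Gamma> y u' v) x t)) (at x)"
    by (rule has_derivative_transform_within_open[OF _ open_S assms]) (simp add: conn_simps)
  then show ?thesis by (simp add: D_eqI)
qed

lemma D_conn_scale:
  assumes "x \<in> S"
  shows "D (\<lambda>y. \<Gamma> y (r *\<^sub>R u) v) x t = r *\<^sub>R D (\<lambda>y. \<Gamma> y u v) x t"
proof -
  have "((\<lambda>y. r *\<^sub>R \<Gamma> y u v) has_derivative (\<lambda>t. r *\<^sub>R D (\<lambda>y. \<Gamma> y u v) x t)) (at x)"
    by (intro has_derivative_scaleR_right D_has_derivative conn_differentiable assms)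
  then have "((\<lambda>y. \<Gamma> y (r *\<^sub>R u) v) has_derivative (\<lambda>t. r *\<^sub>R D (\<lambda>y. \<Gamma> y u v) x t)) (at x)"
    by (rule has_derivative_transform_within_open[OF _ open_S assms]) (simp add: conn_simps)
  then show ?thesis by (simp add: D_eqI)
qed

lemma curv_at_linear:
  assumes "x \<in> S"
  shows "linear (\<lambda>u. curv_at \<Gamma> x u v w)"
proof -
  have lin: "linear (D (\<lambda>y. \<Gamma> y v w) x)" for v w
    by (intro linear_frechet_derivative conn_differentiable assms)
  show ?thesis
    by (rule linearI)
      (simp_all add: curv_at_eq assms conn_simps D_conn_add D_conn_scale
        linear_add[OF lin] linear_scale[OF lin] algebra_simps)
qed

lemma curv_at_bianchi:
  assumes "x \<in> S"
  shows "curv_at \<Gamma> x u v w + curv_at \<Gamma> x v w u + curv_at \<Gamma> x w u v = 0"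
  using assms
  by (simp add: curv_at_eq D_conn_swap[OF assms, of w v] D_conn_swap[OF assms, of w u]
      D_conn_swap[OF assms, of u v] conn_sym[OF assms, of w v] conn_sym[OF assms, of w u]
      conn_sym[OF assms, of u v])

text \<open>Second derivatives of \<open>g(w,z)\<close> commute, so the curvature operator is skew.\<close>

lemma curv_at_skew:
  assumes x: "x \<in> S"
  shows "g x (curv_at \<Gamma> x u v w) z = - g x w (curv_at \<Gamma> x u v z)"
proof -
  have second: "D (\<lambda>y. D (\<lambda>y. g y w z) y v) x u =
      g x (D (\<lambda>y. \<Gamma> y v w) x u + \<Gamma> x u (\<Gamma> x v w)) z + g x (\<Gamma> x v w) (\<Gamma> x u z)
      + g x (\<Gamma> x u w) (\<Gamma> x v z) + g x w (D (\<lambda>y. \<Gamma> y v z) x u + \<Gamma> x u (\<Gamma> x v z))" for u v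
  proof -
    have "((\<lambda>y. g y (\<Gamma> y v w) z + g y w (\<Gamma> y v z)) has_derivative
      (\<lambda>t. (D (\<lambda>y. g y (\<Gamma> x v w) z) x t + g x (D (\<lambda>y. \<Gamma> y v w) x t) z + g x (\<Gamma> x v w) (D (\<lambda>y. z) x t))
        + (D (\<lambda>y. g y w (\<Gamma> x v z)) x t + g x (D (\<lambda>y. w) x t) (\<Gamma> x v z) + g x w (D (\<lambda>y. \<Gamma> y v z) x t))))
      (at x)"
      by (intro has_derivative_add has_derivative_bilinear_field[OF open_S x met_bilinear]
          met_differentiable conn_differentiable x differentiable_const)
    then have "((\<lambda>y. D (\<lambda>y. g y w z) y v) has_derivative
      (\<lambda>t. (D (\<lambda>y. g y (\<Gamma> x v w) z) x t + g x (D (\<lambda>y. \<Gamma> y v w) x t) z + g x (\<Gamma> x v w) (D (\<lambda>y. z) x t))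
        + (D (\<lambda>y. g y w (\<Gamma> x v z)) x t + g x (D (\<lambda>y. w) x t) (\<Gamma> x v z) + g x w (D (\<lambda>y. \<Gamma> y v z) x t))))
      (at x)"
      by (rule has_derivative_transform_within_open[OF _ open_S x]) (simp add: conn_met)
    then show ?thesis by (simp add: D_eqI conn_met met_simps x)
  qed
  show ?thesis
    using symmetric_second_derivative[OF open_S x met_smooth[of w z], of v u]
    unfolding second by (simp add: curv_at_eq met_simps x)
qed

end


section \<open>The curvature of a complex space form\<close>

locale kaehler_chart = levi_civita_chart S g \<Gamma>
  for S :: "'v::euclidean_space set" and g \<Gamma> +
  fixes J :: "'v \<Rightarrow> 'v \<Rightarrow> 'v"
  assumes J_linear: "x \<in> S \<Longrightarrow> linear (J x)"
    and J_J: "x \<in> S \<Longrightarrow> J x (J x u) = - u"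
    and J_met: "x \<in> S \<Longrightarrow> g x (J x u) (J x v) = g x u v"
    and J_smooth: "smooth_on S (\<lambda>x. J x u)"
    and J_parallel: "x \<in> S \<Longrightarrow> D (\<lambda>y. J y v) x u + \<Gamma> x u (J x v) = J x (\<Gamma> x u v)"
begin

lemma J_skew:
  assumes "x \<in> S"
  shows "g x (J x u) v = - g x u (J x v)"
  using J_met[OF assms, of u "J x v"] by (simp add: J_J met_simps assms)

lemma J_differentiable: "x \<in> S \<Longrightarrow> (\<lambda>y. J y u) differentiable (at x)"
  using smooth_on_differentiable[OF J_smooth] .

text \<open>
  Differentiate \<open>\<nabla>\<^sub>v (J w) = J \<nabla>\<^sub>v w\<close> once more, in the direction \<open>u\<close>, and antisymmetrise in \<open>u\<close> and
  \<open>v\<close>: the second derivatives of \<open>J\<close> cancel, and the first derivatives are given by \<open>\<nabla>J = 0\<close>.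
\<close>

lemma curv_at_J:
  assumes x: "x \<in> S"
  shows "curv_at \<Gamma> x u v (J x w) = J x (curv_at \<Gamma> x u v w)"
proof -
  interpret Jx: linear "J x" using J_linear[OF x] .
  have par: "D (\<lambda>y. J y w) x u = J x (\<Gamma> x u w) - \<Gamma> x u (J x w)" for u w
    using J_parallel[OF x, of w u] by (simp add: algebra_simps)
  \<comment> \<open>The derivative in direction \<open>u\<close> of the identity \<open>\<nabla>\<^sub>v (Jw) = J \<nabla>\<^sub>v w\<close>.\<close>
  have deriv: "D (\<lambda>y. D (\<lambda>y. J y w) y v) x u + (D (\<lambda>y. \<Gamma> y v (J x w)) x u + \<Gamma> x v (D (\<lambda>y. J y w) x u)) =
      D (\<lambda>y. J y (\<Gamma> x v w)) x u + J x (D (\<lambda>y. \<Gamma> y v w) x u)" for u v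
  proof -
    have lhs: "((\<lambda>y. D (\<lambda>y. J y w) y v + \<Gamma> y v (J y w)) has_derivative
        (\<lambda>t. D (\<lambda>y. D (\<lambda>y. J y w) y v) x t + (D (\<lambda>y. \<Gamma> y v (J x w)) x t + \<Gamma> x v (D (\<lambda>y. J y w) x t))))
        (at x)"
      using conn_bilinear
      by (intro has_derivative_add D_has_derivative has_derivative_linear_field[OF open_S x]
          smooth_on_differentiable[OF smooth_on_D[OF J_smooth]] conn_differentiable J_differentiable x)
        (simp add: bilinear_def)
    have "((\<lambda>y. J y (\<Gamma> y v w)) has_derivative
        (\<lambda>t. D (\<lambda>y. J y (\<Gamma> x v w)) x t + J x (D (\<lambda>y. \<Gamma> y v w) x t))) (at x)"
      by (intro has_derivative_linear_field[OF open_S x] J_linear J_differentiable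
          conn_differentiable x)
    then have rhs: "((\<lambda>y. D (\<lambda>y. J y w) y v + \<Gamma> y v (J y w)) has_derivative
        (\<lambda>t. D (\<lambda>y. J y (\<Gamma> x v w)) x t + J x (D (\<lambda>y. \<Gamma> y v w) x t))) (at x)"
      by (rule has_derivative_transform_within_open[OF _ open_S x]) (simp add: J_parallel)
    show ?thesis by (rule fun_cong[OF has_derivative_unique[OF lhs rhs]])
  qed
  from arg_cong2[OF deriv[of v u] deriv[of u v], of "(-)"]
    symmetric_second_derivative[OF open_S x J_smooth[of w], of v u]
  show ?thesis
    by (simp add: curv_at_eq x par conn_simps Jx.add Jx.diff algebra_simps)
qed

text \<open>
  The curvature tensor of a complex space form at equal second and third arguments, as they occur in a
  trace. The model tensor has the symmetries of a Kaehler curvature tensor and holomorphic sectional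
  curvatures \<open>4 \<epsilon>\<close>, so its difference \<open>T\<close> from the curvature has vanishing ones.
\<close>

lemma constant_holomorphic_curvature:
  assumes x: "x \<in> S"
    and sec: "\<And>u. u \<noteq> 0 \<Longrightarrow> sectional_curvature g \<Gamma> x u (J x u) = 4 * \<epsilon>"
  shows "curv_at \<Gamma> x u v v =
    \<epsilon> *\<^sub>R (g x v v *\<^sub>R u - g x u v *\<^sub>R v + (3 * g x u (J x v)) *\<^sub>R J x v)"
proof (rule met_nondegenerate[OF x])
  fix z
  \<comment> \<open>The model tensor is written with the metric and the Kaehler form \<open>om\<close>, which turns its symmetries
    into those of \<open>g\<close> and \<open>om\<close>.\<close>
  define om where "om = (\<lambda>u v. g x u (J x v))"
  define T where "T = (\<lambda>u v w z. g x (curv_at \<Gamma> x u v w) z - \<epsilon> *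
    (g x v w * g x u z - g x u w * g x v z - om w v * om u z + om w u * om v z - 2 * om u v * om w z))"
  interpret Jx: linear "J x" using J_linear[OF x] .
  interpret c: linear "\<lambda>u. curv_at \<Gamma> x u v w" for v w using curv_at_linear[OF x] .
  have om_skew: "om u v = - om v u" for u v
    using J_skew[OF x, of v u] met_sym[OF x, of "J x v" u] by (simp add: om_def)
  have om_J: "om (J x u) v = g x u v" "om u (J x v) = - g x u v" "g x u (J x v) = om u v"
    "g x (J x u) v = - om u v" for u v
    by (simp_all add: om_def J_met J_J J_skew met_simps x)
  have om_lin: "om (u + u') v = om u v + om u' v" "om u (v + v') = om u v + om u v'"
    "om (r *\<^sub>R u) v = r * om u v" "om u (r *\<^sub>R v) = r * om u v" for u u' v v' r
    by (simp_all add: om_def Jx.add Jx.scale met_simps x)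
  interpret kaehler_curvature_like T "J x"
  proof
    fix u v w z :: 'v
    have order: "g x v u = g x u v" "g x w u = g x u w" "g x w v = g x v w"
      "g x z u = g x u z" "g x z v = g x v z" "g x z w = g x w z"
      by (rule met_sym[OF x])+
    have om_order: "om v u = - om u v" "om w u = - om u w" "om w v = - om v w"
      "om z u = - om u z" "om z v = - om v z" "om z w = - om w z"
      by (rule om_skew)+
    show "T (u + u') v w z = T u v w z + T u' v w z" for u'
      by (simp add: T_def c.add om_lin met_simps x algebra_simps)
    show "T (r *\<^sub>R u) v w z = r *\<^sub>R T u v w z" for r
      by (simp add: T_def c.scale om_lin met_simps x algebra_simps)
    show "T u v w z = - T v u w z"
      by (simp add: T_def curv_at_antisym[OF x, of v u] om_order met_simps x algebra_simps)
    show "T u v w z = - T u v z w"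
      using curv_at_skew[OF x, of u v w z] met_sym[OF x, of w "curv_at \<Gamma> x u v z"]
      by (simp add: T_def order om_order algebra_simps)
    have "g x (curv_at \<Gamma> x u v w) z + g x (curv_at \<Gamma> x v w u) z + g x (curv_at \<Gamma> x w u v) z =
        g x (curv_at \<Gamma> x u v w + curv_at \<Gamma> x v w u + curv_at \<Gamma> x w u v) z"
      by (simp add: met_simps x)
    also have "\<dots> = 0"
      by (simp add: curv_at_bianchi x met_simps)
    finally have "g x (curv_at \<Gamma> x w u v) z =
        - g x (curv_at \<Gamma> x u v w) z - g x (curv_at \<Gamma> x v w u) z"
      by simp
    then show "T u v w z + T v w u z + T w u v z = 0"
      by (simp add: T_def order om_order algebra_simps)
    show "T u v (J x w) (J x z) = T u v w z"
      by (simp add: T_def curv_at_J x J_met om_J) (simp add: order om_order algebra_simps)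
  qed (use x in \<open>auto simp: J_J J_linear Jx.add Jx.scale\<close>)
  have "T u (J x u) (J x u) u = 0" for u
  proof (cases "u = 0")
    case True
    then show ?thesis by (simp add: T_def om_def met_simps x)
  next
    case False
    have om_self: "om u u = 0" using om_skew[of u u] by simp
    have "g x u u \<noteq> 0" using met_pos[OF x False] by simp
    then have "g x (curv_at \<Gamma> x u (J x u) (J x u)) u = 4 * \<epsilon> * (g x u u * g x u u)"
      using sec[OF False]
      by (simp add: sectional_curvature_def J_met x om_self om_J divide_simps power2_eq_square)
    then show ?thesis
      by (simp add: T_def J_met x om_self om_J algebra_simps)
  qed
  from zero_holomorphic_curvature_imp_zero[OF this, of u v z]
  have "g x (curv_at \<Gamma> x u v v) z = \<epsilon> *
    (g x v v * g x u z - g x u v * g x v z - om v v * om u z + om v u * om v z - 2 * om u v * om v z)"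
    by (simp add: T_def)
  moreover have "om v v = 0" "om v u = - om u v" using om_skew[of v v] om_skew[of v u] by simp_all
  ultimately show "g x (curv_at \<Gamma> x u v v) z =
    g x (\<epsilon> *\<^sub>R (g x v v *\<^sub>R u - g x u v *\<^sub>R v + (3 * g x u (J x v)) *\<^sub>R J x v)) z"
    by (simp add: om_J met_simps x algebra_simps)
qed

end

section \<open>Orthonormal bases\<close>

text \<open>
  Orthonormal vectors are independent, so \<open>DIM('a)\<close> of them span; the difference of the two sides is
  orthogonal to all of them, hence to itself. The inner product \<open>b\<close> is a parameter since it will be a
  Riemannian metric at a point, and the index type is left free since the vectors will be indexed by a
  disjoint sum.
\<close>

lemma orthonormal_expansion:
  fixes b :: "'a::euclidean_space \<Rightarrow> 'a \<Rightarrow> real" and E :: "'i \<Rightarrow> 'a"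
  assumes b: "bilinear b" and pos: "\<And>u. u \<noteq> 0 \<Longrightarrow> b u u > 0"
    and I: "finite I" "card I = DIM('a)"
    and ortho: "\<And>i j. i \<in> I \<Longrightarrow> j \<in> I \<Longrightarrow> b (E i) (E j) = (if i = j then 1 else 0)"
  shows "(\<Sum>i\<in>I. b v (E i) *\<^sub>R E i) = v"
proof -
  have lin: "linear (\<lambda>v. b v w)" "linear (\<lambda>v. b w v)" for w using b by (simp_all add: bilinear_def)
  have inj: "inj_on E I"
    by (rule inj_onI) (metis ortho zero_neq_one)
  have "independent (E ` I)"
  proof (rule independent_if_scalars_zero)
    fix c x assume sum0: "(\<Sum>y\<in>E ` I. c y *\<^sub>R y) = 0" and "x \<in> E ` I"
    then obtain j where j: "j \<in> I" "x = E j" by auto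
    have "0 = b (\<Sum>i\<in>I. c (E i) *\<^sub>R E i) (E j)"
      using sum0 by (simp add: sum.reindex[OF inj] bilinear_lzero[OF b])
    also have "\<dots> = (\<Sum>i\<in>I. c (E i) * b (E i) (E j))"
      by (simp add: linear_sum[OF lin(1)] bilinear_lmul[OF b])
    also have "\<dots> = (\<Sum>i\<in>I. if i = j then c (E i) else 0)"
      using j ortho by (intro sum.cong) auto
    also have "\<dots> = c x" using j I by simp
    finally show "c x = 0" by simp
  qed (use I in simp)
  moreover have "dim (UNIV :: 'a set) \<le> card (E ` I)"
    using I by (simp add: card_image[OF inj])
  ultimately have span: "span (E ` I) = UNIV"
    using card_ge_dim_independent[of "E ` I" UNIV] by auto
  define w where "w = (\<Sum>i\<in>I. b v (E i) *\<^sub>R E i) - v"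
  have zero: "b w (E j) = 0" if j: "j \<in> I" for j
  proof -
    have "(\<Sum>i\<in>I. b v (E i) * b (E i) (E j)) = (\<Sum>i\<in>I. if i = j then b v (E i) else 0)"
      using j ortho by (intro sum.cong) auto
    then show ?thesis
      using j I by (simp add: w_def bilinear_lsub[OF b] linear_sum[OF lin(1)] bilinear_lmul[OF b])
  qed
  have "b w u = 0" if "u \<in> span (E ` I)" for u
    using that
    by (induction rule: span_induct_alt)
      (auto simp: zero bilinear_radd[OF b] bilinear_rmul[OF b] bilinear_rzero[OF b])
  then have "b w w = 0" using span by auto
  then have "w = 0" using pos by force
  then show ?thesis by (simp add: w_def)
qed


section \<open>Isometric immersions in charts\<close>

locale isometric_chart =
  M: levi_civita_chart U g \<Gamma> + N: levi_civita_chart V h \<Gamma>'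
  for U :: "'v::euclidean_space set" and g \<Gamma>
    and V :: "'e::euclidean_space set" and h \<Gamma>' +
  fixes W :: "'v set" and f :: "'v \<Rightarrow> 'e"
  assumes open_W: "open W" and W_subset: "W \<subseteq> U"
    and f_in: "x \<in> W \<Longrightarrow> f x \<in> V"
    and f_smooth: "smooth_on W f"
    and isometric: "x \<in> W \<Longrightarrow> g x u v = h (f x) (D f x u) (D f x v)"
begin

lemma in_U: "x \<in> W \<Longrightarrow> x \<in> U"
  using W_subset by auto

lemma Df_linear: "x \<in> W \<Longrightarrow> linear (D f x)"
  using smooth_on_differentiable[OF f_smooth] by (rule linear_frechet_derivative)

lemma dmap_smooth: "smooth_on W X \<Longrightarrow> smooth_on W (dmap f X)"
  unfolding dmap_def[abs_def]
  by (rule smooth_on_linear_field[OF open_W Df_linear smooth_on_D[OF f_smooth]])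

lemma pull_conn_smooth: "smooth_on W (\<lambda>x. \<Gamma>' (f x) u v)"
  by (rule smooth_on_compose[OF open_W _ f_smooth N.conn_smooth]) (use f_in in auto)

lemma pull_met_smooth: "smooth_on W (\<lambda>x. h (f x) u v)"
  by (rule smooth_on_compose[OF open_W _ f_smooth N.met_smooth]) (use f_in in auto)

lemma smooth_on_D_field:
  fixes Y :: "'v \<Rightarrow> 'w::real_normed_vector"
  shows "smooth_on W X \<Longrightarrow> smooth_on W Y \<Longrightarrow> smooth_on W (\<lambda>x. D Y x (X x))"
  by (rule smooth_on_linear_field[OF open_W])
    (auto intro: linear_frechet_derivative smooth_on_differentiable smooth_on_D)

lemma pcov_smooth:
  assumes "smooth_on W X" "smooth_on W S"
  shows "smooth_on W (pcov \<Gamma>' f X S)"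
  unfolding pcov_def[abs_def]
  by (intro smooth_on_add open_W smooth_on_D_field assms
      smooth_on_bilinear_field[OF open_W N.conn_bilinear pull_conn_smooth] f_in dmap_smooth)

lemma cov_smooth:
  assumes "smooth_on W X" "smooth_on W Y"
  shows "smooth_on W (cov \<Gamma> X Y)"
  unfolding cov_def[abs_def]
  by (intro smooth_on_add open_W smooth_on_D_field assms in_U
      smooth_on_bilinear_field[OF open_W M.conn_bilinear smooth_on_subset[OF M.conn_smooth W_subset]])

lemma second_ff_smooth:
  assumes "smooth_on W X" "smooth_on W Y"
  shows "smooth_on W (second_ff \<Gamma> \<Gamma>' f X Y)"
  unfolding second_ff_def[abs_def]
  by (intro smooth_on_diff open_W pcov_smooth dmap_smooth cov_smooth assms)

lemma pcov_add:
  assumes "S differentiable (at x)" "S' differentiable (at x)" "x \<in> W"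
  shows "pcov \<Gamma>' f X (\<lambda>y. S y + S' y) x = pcov \<Gamma>' f X S x + pcov \<Gamma>' f X S' x"
  using D_eqI[OF has_derivative_add[OF D_has_derivative[OF assms(1)] D_has_derivative[OF assms(2)]]]
  by (simp add: pcov_def N.conn_simps f_in assms)

text \<open>
  By the product rule, only the derivative of \<open>h \<circ> f\<close> at fixed arguments remains to be expressed by
  Christoffel symbols, and the chain rule reduces it to the derivative of \<open>h\<close> in the direction \<open>df(X)\<close>.
\<close>

lemma pcov_met:
  assumes x: "x \<in> W" and S: "S differentiable (at x)" "S' differentiable (at x)"
  shows "D (\<lambda>y. h (f y) (S y) (S' y)) x (X x) =
    h (f x) (pcov \<Gamma>' f X S x) (S' x) + h (f x) (S x) (pcov \<Gamma>' f X S' x)"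
proof -
  have "((\<lambda>y. h (f y) (S y) (S' y)) has_derivative (\<lambda>t. D (\<lambda>y. h (f y) (S x) (S' x)) x t
      + h (f x) (D S x t) (S' x) + h (f x) (S x) (D S' x t))) (at x)"
    using smooth_on_differentiable[OF pull_met_smooth x]
    by (intro has_derivative_bilinear_field[OF open_W x] N.met_bilinear f_in S)
  moreover have "D (\<lambda>y. h (f y) u v) x t = D (\<lambda>y. h y u v) (f x) (D f x t)" for u v t
    using D_eqI[OF has_derivative_compose[OF D_has_derivative[OF smooth_on_differentiable[OF f_smooth x]]
          D_has_derivative[OF N.met_differentiable[OF f_in[OF x], of u v]]]]
    by simp
  ultimately show ?thesis
    by (simp add: D_eqI pcov_def dmap_def N.conn_met N.met_simps f_in x)
qed

text \<open>
  The derivatives of the components of \<open>Y\<close> contribute \<open>df(D Y X)\<close> to both terms of the second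
  fundamental form and cancel.
\<close>

lemma second_ff_tensorial:
  assumes x: "x \<in> W" and Y: "Y differentiable (at x)"
  shows "second_ff \<Gamma> \<Gamma>' f X Y x = second_ff \<Gamma> \<Gamma>' f (\<lambda>_. X x) (\<lambda>_. Y x) x"
proof -
  have "((\<lambda>y. D f y (Y y)) has_derivative
      (\<lambda>t. D (\<lambda>y. D f y (Y x)) x t + D f x (D Y x t))) (at x)"
    using smooth_on_differentiable[OF smooth_on_D[OF f_smooth] x]
    by (intro has_derivative_linear_field[OF open_W x] Df_linear Y)
  then show ?thesis
    by (simp add: second_ff_def pcov_def cov_def dmap_def[abs_def] D_eqI linear_add[OF Df_linear[OF x]])
qed

text \<open>
  By tensoriality, constant fields suffice. For them the claim is the symmetry of the second derivative
  of \<open>f\<close> together with that of both sets of Christoffel symbols.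
\<close>

lemma second_ff_sym:
  assumes x: "x \<in> W" and X: "X differentiable (at x)" and Y: "Y differentiable (at x)"
  shows "second_ff \<Gamma> \<Gamma>' f X Y x = second_ff \<Gamma> \<Gamma>' f Y X x"
  unfolding second_ff_tensorial[OF x X] second_ff_tensorial[OF x Y]
  using symmetric_second_derivative[OF open_W x f_smooth, of "Y x" "X x"]
  by (simp add: second_ff_def pcov_def cov_def dmap_def[abs_def]
      N.conn_sym[OF f_in[OF x], of "D f x (X x)"] M.conn_sym[OF in_U[OF x], of "X x"])

lemma second_ff_minus:
  assumes x: "x \<in> W" and Y: "smooth_on W Y"
  shows "second_ff \<Gamma> \<Gamma>' f (\<lambda>y. - X y) Y x = - second_ff \<Gamma> \<Gamma>' f X Y x"
proof -
  have "linear (D Y x)" "linear (D (dmap f Y) x)"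
    using smooth_on_differentiable[OF Y x] smooth_on_differentiable[OF dmap_smooth[OF Y] x]
    by (auto intro: linear_frechet_derivative)
  then show ?thesis
    by (simp add: second_ff_def pcov_def cov_def dmap_def linear_neg linear_add linear_diff
        Df_linear[OF x] M.conn_simps N.conn_simps in_U f_in x)
qed

text \<open>
  The trilinear form \<open>h(B(u,v), df w)\<close> is symmetric in \<open>u, v\<close>; comparing the metric compatibility of
  both connections shows that it is skew in \<open>v, w\<close>. Hence it is zero.
\<close>

lemma second_ff_normal:
  assumes x: "x \<in> W" and Y: "Y differentiable (at x)"
  shows "h (f x) (second_ff \<Gamma> \<Gamma>' f X Y x) (D f x w) = 0"
proof -
  define B where "B = (\<lambda>u v. second_ff \<Gamma> \<Gamma>' f (\<lambda>_. u) (\<lambda>_. v) x)"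
  define T where "T = (\<lambda>u v w. h (f x) (B u v) (D f x w))"
  have sym: "T u v w = T v u w" for u v w
    using second_ff_sym[OF x, of "\<lambda>_. u" "\<lambda>_. v"] by (simp add: T_def B_def)
  have skew: "T u v w = - T u w v" for u v w
  proof -
    have diff: "(\<lambda>y. D f y v) differentiable (at x)" for v
      using smooth_on_differentiable[OF smooth_on_D[OF f_smooth] x] .
    have "D (\<lambda>y. h (f y) (D f y v) (D f y w)) x u = D (\<lambda>y. g y v w) x u"
      using frechet_derivative_transform_within_open[OF M.met_differentiable[OF in_U[OF x]]
          open_W x isometric] by simp
    also have "\<dots> = h (f x) (D f x (\<Gamma> x u v)) (D f x w) + h (f x) (D f x v) (D f x (\<Gamma> x u w))"
      by (simp add: M.conn_met in_U isometric x)
    finally have "h (f x) (pcov \<Gamma>' f (\<lambda>_. u) (\<lambda>y. D f y v) x) (D f x w) +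
        h (f x) (D f x v) (pcov \<Gamma>' f (\<lambda>_. u) (\<lambda>y. D f y w) x) =
        h (f x) (D f x (\<Gamma> x u v)) (D f x w) + h (f x) (D f x v) (D f x (\<Gamma> x u w))"
      using pcov_met[OF x diff[of v] diff[of w], of "\<lambda>_. u"] by simp
    moreover have "B u v = pcov \<Gamma>' f (\<lambda>_. u) (\<lambda>y. D f y v) x - D f x (\<Gamma> x u v)" for v
      by (simp add: B_def second_ff_def dmap_def[abs_def] cov_def)
    ultimately show ?thesis
      using N.met_sym[OF f_in[OF x], of "B u w" "D f x v"]
      by (simp add: T_def N.met_simps f_in x)
  qed
  have "T u v w = 0" for u v w
    using skew[of u v w] sym[of u w v] skew[of w u v] sym[of w v u] skew[of v w u] sym[of v u w]
    by simp
  then show ?thesis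
    unfolding second_ff_tensorial[OF x Y] T_def B_def .
qed

end


section \<open>Decomposition along an orthonormal frame\<close>

locale framed_isometric_chart = isometric_chart U g \<Gamma> V h \<Gamma>' W f
  for U :: "'v::euclidean_space set" and g \<Gamma>
    and V :: "'e::euclidean_space set" and h \<Gamma>' W f +
  fixes e :: "nat \<Rightarrow> 'v \<Rightarrow> 'v"
  assumes frame_smooth: "i < DIM('v) \<Longrightarrow> smooth_on W (e i)"
    and frame_ortho: "x \<in> W \<Longrightarrow> i < DIM('v) \<Longrightarrow> j < DIM('v) \<Longrightarrow>
      g x (e i x) (e j x) = (if i = j then 1 else 0)"
begin

lemma frame_expansion:
  assumes "x \<in> W"
  shows "(\<Sum>i<DIM('v). g x u (e i x) *\<^sub>R e i x) = u"
  by (rule orthonormal_expansion)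
    (use assms in_U M.met_bilinear M.met_pos frame_ortho in auto)

text \<open>
  By the expansion of \<open>u\<close> in the frame, it suffices to test against \<open>df(e\<^sub>j)\<close>.
\<close>

lemma frame_projection_normal:
  assumes x: "x \<in> W"
  shows "h (f x) (s - D f x (\<Sum>i<DIM('v). h (f x) s (D f x (e i x)) *\<^sub>R e i x)) (D f x u) = 0"
    (is "h (f x) (s - D f x ?w) _ = 0")
proof -
  note lin = Df_linear[OF x]
  have ortho: "h (f x) (D f x (e i x)) (D f x (e j x)) = (if i = j then 1 else 0)"
    if "i < DIM('v)" "j < DIM('v)" for i j
    using frame_ortho[OF x that] isometric[OF x] by simp
  have hlin: "linear (\<lambda>s. h (f x) s v)" "linear (h (f x) v)" for v
    using N.met_bilinear[OF f_in[OF x]] by (simp_all add: bilinear_def)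
  have w_frame: "h (f x) (s - D f x ?w) (D f x (e j x)) = 0" if j: "j < DIM('v)" for j
  proof -
    have "h (f x) (D f x ?w) (D f x (e j x)) =
        (\<Sum>i<DIM('v). h (f x) s (D f x (e i x)) * h (f x) (D f x (e i x)) (D f x (e j x)))"
      by (simp add: linear_sum[OF lin] linear_scale[OF lin] linear_sum[OF hlin(1)]
          linear_scale[OF hlin(1)])
    also have "\<dots> = (\<Sum>i<DIM('v). if i = j then h (f x) s (D f x (e i x)) else 0)"
      using j ortho by (intro sum.cong) auto
    finally show ?thesis using j by (simp add: linear_diff[OF hlin(1)])
  qed
  have "h (f x) (s - D f x ?w) (D f x (\<Sum>i<DIM('v). g x u (e i x) *\<^sub>R e i x)) =
      (\<Sum>i<DIM('v). g x u (e i x) * h (f x) (s - D f x ?w) (D f x (e i x)))"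
    unfolding linear_sum[OF lin, where g = "\<lambda>i. g x u (e i x) *\<^sub>R e i x"] linear_sum[OF hlin(2)]
      linear_scale[OF lin] linear_scale[OF hlin(2)] by simp
  also have "\<dots> = 0" using w_frame by simp
  finally show ?thesis by (simp only: frame_expansion[OF x])
qed

text \<open>
  An explicit formula for the tangential part: it shows that the definite description in its
  definition is met by exactly one vector, and that the tangential part of a smooth section is smooth.
\<close>

lemma tan_part_eq:
  assumes x: "x \<in> W"
  shows "tan_part h f S x = (\<Sum>i<DIM('v). h (f x) (S x) (D f x (e i x)) *\<^sub>R e i x)"
    (is "_ = ?w")
  unfolding tan_part_def
proof (rule the_equality)
  show "\<forall>u. h (f x) (S x - D f x ?w) (D f x u) = 0"
    using frame_projection_normal[OF x] by blast
  fix w' assume "\<forall>u. h (f x) (S x - D f x w') (D f x u) = 0"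
  then have "g x w' u = g x ?w u" for u
    using frame_projection_normal[OF x, of "S x" u]
    by (simp add: isometric[OF x] N.met_simps f_in x)
  then show "w' = ?w" by (rule M.met_nondegenerate[OF in_U[OF x]])
qed

lemma tan_part_normal:
  assumes x: "x \<in> W"
  shows "h (f x) (S x - D f x (tan_part h f S x)) (D f x u) = 0"
  unfolding tan_part_eq[OF x] by (rule frame_projection_normal[OF x])

lemma tan_part_smooth:
  assumes "smooth_on W S"
  shows "smooth_on W (tan_part h f S)"
proof (rule smooth_on_cong[OF open_W])
  show "(\<Sum>i<DIM('v). h (f x) (S x) (dmap f (e i) x) *\<^sub>R e i x) = tan_part h f S x" if "x \<in> W" for x
    using tan_part_eq[OF that] by (simp add: dmap_def)
  show "smooth_on W (\<lambda>x. \<Sum>i<DIM('v). h (f x) (S x) (dmap f (e i) x) *\<^sub>R e i x)"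
    using frame_smooth
    by (intro smooth_on_sum smooth_on_scaleR open_W dmap_smooth assms f_in
        smooth_on_bilinear_field[OF open_W N.met_bilinear pull_met_smooth]) auto
qed


lemma ncov_smooth:
  assumes "smooth_on W X" "smooth_on W \<xi>"
  shows "smooth_on W (ncov h \<Gamma>' f X \<xi>)"
  unfolding ncov_def[abs_def]
  by (intro smooth_on_diff open_W pcov_smooth dmap_smooth tan_part_smooth assms)

lemma ncov_normal: "x \<in> W \<Longrightarrow> h (f x) (ncov h \<Gamma>' f X \<xi> x) (D f x u) = 0"
  unfolding ncov_def dmap_def by (rule tan_part_normal)

lemma weingarten:
  assumes "x \<in> W"
  shows "pcov \<Gamma>' f X \<xi> x = ncov h \<Gamma>' f X \<xi> x - D f x (shape h \<Gamma>' f \<xi> X x)"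
  by (simp add: ncov_def shape_def dmap_def linear_neg[OF Df_linear[OF assms]])

text \<open>
  The Weingarten formula splits the inner derivative into the normal section \<open>\<nabla>\<^sup>\<bottom>\<^sub>X \<xi>\<close> and the tangential
  section \<open>- df(A\<^sub>\<xi> X)\<close>. The outer derivative is given by the Weingarten formula for the first and by the
  Gauss formula for the second.
\<close>

lemma pcov_pcov:
  assumes x: "x \<in> W" and X: "smooth_on W X" and Y: "smooth_on W Y" and \<xi>: "smooth_on W \<xi>"
  shows "pcov \<Gamma>' f Y (pcov \<Gamma>' f X \<xi>) x =
    ncov h \<Gamma>' f Y (ncov h \<Gamma>' f X \<xi>) x - second_ff \<Gamma> \<Gamma>' f (shape h \<Gamma>' f \<xi> X) Y x
    - D f x (cov \<Gamma> Y (shape h \<Gamma>' f \<xi> X) x + shape h \<Gamma>' f (ncov h \<Gamma>' f X \<xi>) Y x)"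
proof -
  define T where "T = tan_part h f (pcov \<Gamma>' f X \<xi>)"
  note diff = smooth_on_differentiable[OF _ x]
  have T: "smooth_on W T"
    unfolding T_def by (intro tan_part_smooth pcov_smooth X \<xi>)
  have shape: "shape h \<Gamma>' f \<xi> X = (\<lambda>y. - T y)"
    by (rule ext) (simp add: shape_def T_def)
  have "D (\<lambda>y. - T y) x = (\<lambda>t. - D T x t)"
    by (rule D_eqI[OF has_derivative_minus[OF D_has_derivative[OF diff[OF T]]]])
  then have cov: "cov \<Gamma> Y (shape h \<Gamma>' f \<xi> X) x = - cov \<Gamma> Y T x"
    by (simp add: shape cov_def M.conn_simps in_U x)
  have B: "second_ff \<Gamma> \<Gamma>' f (shape h \<Gamma>' f \<xi> X) Y x = - second_ff \<Gamma> \<Gamma>' f Y T x"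
    using second_ff_sym[OF x diff[OF T] diff[OF Y]] by (simp add: shape second_ff_minus[OF x Y])
  have "pcov \<Gamma>' f X \<xi> = (\<lambda>y. ncov h \<Gamma>' f X \<xi> y + dmap f T y)"
    by (rule ext) (simp add: ncov_def T_def)
  then have "pcov \<Gamma>' f Y (pcov \<Gamma>' f X \<xi>) x =
      pcov \<Gamma>' f Y (ncov h \<Gamma>' f X \<xi>) x + pcov \<Gamma>' f Y (dmap f T) x"
    using pcov_add[OF diff[OF ncov_smooth[OF X \<xi>]] diff[OF dmap_smooth[OF T]] x] by simp
  also have "pcov \<Gamma>' f Y (dmap f T) x = second_ff \<Gamma> \<Gamma>' f Y T x + D f x (cov \<Gamma> Y T x)"
    by (simp add: second_ff_def dmap_def)
  finally show ?thesis
    by (simp add: weingarten[OF x, of Y "ncov h \<Gamma>' f X \<xi>"] cov B linear_add[OF Df_linear[OF x]]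
        linear_diff[OF Df_linear[OF x]] linear_neg[OF Df_linear[OF x]])
qed

text \<open>
  The summand \<open>pcov (cov e\<^sub>i e\<^sub>i) \<xi>\<close> supplies, by the Weingarten formula, just the correction terms in
  \<open>(\<nabla>A\<^sub>\<xi>)(e\<^sub>i, e\<^sub>i)\<close> and in the normal Laplacian.
\<close>

lemma rough_laplacian_decomposition:
  assumes x: "x \<in> W" and \<xi>: "smooth_on W \<xi>"
  shows "rough_laplacian \<Gamma> \<Gamma>' f e \<xi> x =
    D f x ((\<Sum>i<DIM('v). cov_shape \<Gamma> h \<Gamma>' f \<xi> (e i) (e i) x)
      + (\<Sum>i<DIM('v). shape h \<Gamma>' f (ncov h \<Gamma>' f (e i) \<xi>) (e i) x))
    + (normal_laplacian \<Gamma> h \<Gamma>' f e \<xi> x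
      + (\<Sum>i<DIM('v). second_ff \<Gamma> \<Gamma>' f (shape h \<Gamma>' f \<xi> (e i)) (e i) x))"
proof -
  note lin = Df_linear[OF x]
  have "pcov \<Gamma>' f (e i) (pcov \<Gamma>' f (e i) \<xi>) x - pcov \<Gamma>' f (cov \<Gamma> (e i) (e i)) \<xi> x =
      (ncov h \<Gamma>' f (e i) (ncov h \<Gamma>' f (e i) \<xi>) x - ncov h \<Gamma>' f (cov \<Gamma> (e i) (e i)) \<xi> x)
      - second_ff \<Gamma> \<Gamma>' f (shape h \<Gamma>' f \<xi> (e i)) (e i) x
      - D f x (cov_shape \<Gamma> h \<Gamma>' f \<xi> (e i) (e i) x + shape h \<Gamma>' f (ncov h \<Gamma>' f (e i) \<xi>) (e i) x)"
    if "i < DIM('v)" for i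
    using frame_smooth[OF that]
    by (simp add: pcov_pcov[OF x _ _ \<xi>] weingarten[OF x, of "cov \<Gamma> (e i) (e i)"] cov_shape_def
        linear_add[OF lin] linear_diff[OF lin])
  then show ?thesis
    by (simp add: rough_laplacian_def normal_laplacian_def sum_subtractf linear_add[OF lin]
        linear_sum[OF lin] sum.distrib)
qed

abbreviation H :: "'v \<Rightarrow> 'e" where "H \<equiv> mean_curv \<Gamma> \<Gamma>' f e"

lemma mean_curv_smooth: "smooth_on W H"
  unfolding mean_curv_def[abs_def] using frame_smooth
  by (intro smooth_on_scaleR smooth_on_const smooth_on_sum open_W second_ff_smooth) auto

definition normal_to :: "'v \<Rightarrow> 'e \<Rightarrow> bool"
  where "normal_to x s \<longleftrightarrow> (\<forall>u. h (f x) s (D f x u) = 0)"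

lemma normal_to_add: "x \<in> W \<Longrightarrow> normal_to x s \<Longrightarrow> normal_to x t \<Longrightarrow> normal_to x (s + t)"
  by (simp add: normal_to_def N.met_simps f_in)

lemma normal_to_scale: "x \<in> W \<Longrightarrow> normal_to x s \<Longrightarrow> normal_to x (r *\<^sub>R s)"
  by (simp add: normal_to_def N.met_simps f_in)

lemma normal_to_diff: "x \<in> W \<Longrightarrow> normal_to x s \<Longrightarrow> normal_to x t \<Longrightarrow> normal_to x (s - t)"
  by (simp add: normal_to_def N.met_simps f_in)

lemma normal_to_minus: "x \<in> W \<Longrightarrow> normal_to x s \<Longrightarrow> normal_to x (- s)"
  by (simp add: normal_to_def N.met_simps f_in)

lemma normal_to_sum:
  assumes "x \<in> W" "\<And>i. i \<in> I \<Longrightarrow> normal_to x (s i)"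
  shows "normal_to x (\<Sum>i\<in>I. s i)"
  using assms(2)
  by (induction I rule: infinite_finite_induct)
    (auto simp: normal_to_add[OF assms(1)], auto simp: normal_to_def N.met_simps f_in assms(1))

lemma normal_to_second_ff:
  "x \<in> W \<Longrightarrow> smooth_on W Y \<Longrightarrow> normal_to x (second_ff \<Gamma> \<Gamma>' f X Y x)"
  unfolding normal_to_def using second_ff_normal[OF _ smooth_on_differentiable] by blast

lemma normal_to_mean_curv: "x \<in> W \<Longrightarrow> normal_to x (H x)"
  unfolding mean_curv_def using frame_smooth
  by (intro normal_to_scale normal_to_sum normal_to_second_ff) auto

lemma normal_to_normal_laplacian: "x \<in> W \<Longrightarrow> normal_to x (normal_laplacian \<Gamma> h \<Gamma>' f e \<xi> x)"
  unfolding normal_laplacian_def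
  by (intro normal_to_minus normal_to_sum normal_to_diff) (auto simp: normal_to_def ncov_normal)

text \<open>
  Pairing with \<open>df(t)\<close> gives \<open>g(t,t) = 0\<close>.
\<close>

lemma tangent_plus_normal_eq_0_iff:
  assumes x: "x \<in> W" and n: "normal_to x n"
  shows "D f x t + n = 0 \<longleftrightarrow> t = 0 \<and> n = 0"
proof
  assume 0: "D f x t + n = 0"
  have "g x t t = h (f x) (D f x t + n) (D f x t)"
    using n by (simp add: isometric x normal_to_def N.met_simps f_in)
  also have "\<dots> = 0" using 0 by (simp add: N.met_simps f_in x)
  finally have "t = 0" using M.met_pos[OF in_U[OF x], of t] by force
  then show "t = 0 \<and> n = 0" using 0 by (simp add: linear_0[OF Df_linear[OF x]])
qed (simp add: linear_0[OF Df_linear[OF x]])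

end


section \<open>Lagrangian immersions into complex space forms\<close>

locale framed_lagrangian_chart =
  framed_isometric_chart U g \<Gamma> V h \<Gamma>' W f e + N: kaehler_chart V h \<Gamma>' J
  for U :: "'v::euclidean_space set" and g \<Gamma>
    and V :: "'e::euclidean_space set" and h \<Gamma>' W f e J +
  fixes \<epsilon> :: real
  assumes dim: "DIM('e) = 2 * DIM('v)"
    and lagrangian: "x \<in> W \<Longrightarrow> h (f x) (J (f x) (D f x u)) (D f x v) = 0"
    and holomorphic_curvature: "y \<in> V \<Longrightarrow> s \<noteq> 0 \<Longrightarrow>
      sectional_curvature h \<Gamma>' y s (J y s) = 4 * \<epsilon>"
begin

text \<open>
  The vectors \<open>df(e\<^sub>i)\<close> and \<open>J df(e\<^sub>i)\<close> are orthonormal, since \<open>J\<close> is an isometry that maps tangent to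
  normal vectors, and there are \<open>DIM('e)\<close> of them. A normal vector has no components along the first.
\<close>

lemma normal_expansion:
  assumes x: "x \<in> W" and n: "normal_to x n"
  shows "(\<Sum>i<DIM('v). h (f x) n (J (f x) (D f x (e i x))) *\<^sub>R J (f x) (D f x (e i x))) = n"
proof -
  define E where "E = case_sum (\<lambda>i. D f x (e i x)) (\<lambda>i. J (f x) (D f x (e i x)))"
  have 0: "h (f x) (D f x u) (J (f x) (D f x v)) = 0" for u v
    using lagrangian[OF x, of v u] N.met_sym[OF f_in[OF x], of "D f x u"] by simp
  have "(\<Sum>i\<in>{..<DIM('v)} <+> {..<DIM('v)}. h (f x) n (E i) *\<^sub>R E i) = n"
  proof (rule orthonormal_expansion)
    fix i j :: "nat + nat"
    assume "i \<in> {..<DIM('v)} <+> {..<DIM('v)}" "j \<in> {..<DIM('v)} <+> {..<DIM('v)}"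
    then show "h (f x) (E i) (E j) = (if i = j then 1 else 0)"
      using frame_ortho[OF x] lagrangian[OF x]
      by (auto simp: E_def N.J_met f_in x 0 isometric[OF x, symmetric] split: if_splits)
  qed (use x f_in N.met_bilinear N.met_pos dim in \<open>auto simp: card_Plus\<close>)
  then show ?thesis
    using n by (simp add: sum.Plus E_def normal_to_def)
qed

text \<open>
  For normal \<open>n\<close>, the term \<open>h(n, df e\<^sub>i) df e\<^sub>i\<close> of the curvature vanishes, and the term with \<open>J\<close> sums to
  three times the expansion of \<open>n\<close> in the vectors \<open>J df(e\<^sub>i)\<close>.
\<close>

lemma curvature_trace:
  assumes x: "x \<in> W" and n: "normal_to x n"
  shows "(\<Sum>i<DIM('v). curv_at \<Gamma>' (f x) n (dmap f (e i) x) (dmap f (e i) x)) =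
    ((real DIM('v) + 3) * \<epsilon>) *\<^sub>R n"
proof -
  have "curv_at \<Gamma>' (f x) n (dmap f (e i) x) (dmap f (e i) x) = \<epsilon> *\<^sub>R n +
      (3 * \<epsilon>) *\<^sub>R (h (f x) n (J (f x) (D f x (e i x))) *\<^sub>R J (f x) (D f x (e i x)))"
    if i: "i < DIM('v)" for i
  proof -
    have "h (f x) (D f x (e i x)) (D f x (e i x)) = 1"
      using frame_ortho[OF x i i] isometric[OF x] by simp
    then show ?thesis
      using n N.constant_holomorphic_curvature[OF f_in[OF x] holomorphic_curvature[OF f_in[OF x]],
          of n "D f x (e i x)"]
      by (simp add: dmap_def normal_to_def scaleR_add_right mult_ac)
  qed
  then have "(\<Sum>i<DIM('v). curv_at \<Gamma>' (f x) n (dmap f (e i) x) (dmap f (e i) x)) =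
      (\<Sum>i<DIM('v). \<epsilon> *\<^sub>R n +
      (3 * \<epsilon>) *\<^sub>R (h (f x) n (J (f x) (D f x (e i x))) *\<^sub>R J (f x) (D f x (e i x))))"
    by (intro sum.cong) auto
  also have "\<dots> = \<epsilon> *\<^sub>R real DIM('v) *\<^sub>R n + (3 * \<epsilon>) *\<^sub>R n"
    by (simp only: sum.distrib scaleR_sum_right[symmetric] normal_expansion[OF x n]
        sum_constant_scaleR card_lessThan)
  finally show ?thesis by (simp add: algebra_simps)
qed

text \<open>
  The left-hand side of the biharmonic equation is \<open>df\<close> of the first expression on the right plus the
  second one, which is normal.
\<close>

lemma biharmonic_iff_components:
  assumes x: "x \<in> W"
  shows "rough_laplacian \<Gamma> \<Gamma>' f e H x
      - (\<Sum>i<DIM('v). curv_at \<Gamma>' (f x) (H x) (dmap f (e i) x) (dmap f (e i) x)) = 0 \<longleftrightarrow>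
    (\<Sum>i<DIM('v). cov_shape \<Gamma> h \<Gamma>' f H (e i) (e i) x)
      + (\<Sum>i<DIM('v). shape h \<Gamma>' f (ncov h \<Gamma>' f (e i) H) (e i) x) = 0 \<and>
    normal_laplacian \<Gamma> h \<Gamma>' f e H x
      + (\<Sum>i<DIM('v). second_ff \<Gamma> \<Gamma>' f (shape h \<Gamma>' f H (e i)) (e i) x)
      - ((real DIM('v) + 3) * \<epsilon>) *\<^sub>R H x = 0"
    (is "?bi = 0 \<longleftrightarrow> ?t = 0 \<and> ?n = 0")
proof -
  have eq: "?bi = D f x ?t + ?n"
    by (simp add: rough_laplacian_decomposition[OF x mean_curv_smooth]
        curvature_trace[OF x normal_to_mean_curv[OF x]])
  have normal: "normal_to x ?n"
    using x frame_smooth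
    by (intro normal_to_diff normal_to_add normal_to_scale normal_to_sum normal_to_second_ff
        normal_to_normal_laplacian normal_to_mean_curv) auto
  show ?thesis unfolding eq by (rule tangent_plus_normal_eq_0_iff[OF x normal])
qed

end

section \<open>From manifolds to charts\<close>

lemma smooth_manifold_inj_on_chart:
  assumes "smooth_manifold M" "c \<in> charts M"
  shows "inj_on (snd c) (fst c)"
proof -
  have "openin (space_of M) (fst c)"
    "homeomorphic_map (subtopology (space_of M) (fst c)) (top_of_set (coords c)) (snd c)"
    using assms by (auto simp: smooth_manifold_def)
  then show ?thesis
    using homeomorphic_imp_injective_map by (metis topspace_subtopology_subset openin_subset)
qed

text \<open>
  The representation of \<open>\<phi>\<close> inverts the chart \<open>c\<close> by \<open>inv_into\<close>, which returns the point itself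
  because \<open>c\<close> is injective on its domain.
\<close>

lemma local_rep_in_coords:
  assumes "smooth_manifold M" "c \<in> charts M" "x \<in> local_dom c d \<phi>"
  shows "local_rep c d \<phi> x \<in> coords d"
proof -
  obtain p where "p \<in> fst c" "\<phi> p \<in> fst d" "x = snd c p"
    using assms(3) by (auto simp: local_dom_def)
  then show ?thesis
    using smooth_manifold_inj_on_chart[OF assms(1,2)] by (simp add: local_rep_def coords_def)
qed

text \<open>
  Constant vector fields are smooth and have vanishing Lie bracket, so evaluating the axioms of the
  Levi-Civita connection on them gives the two identities for the Christoffel symbols.
\<close>

lemma riemannian_manifold_chart:
  assumes "riemannian_manifold M" "c \<in> charts M"
  shows "levi_civita_chart (coords c) (met M c) (conn M c)"
proof -
  have man: "smooth_manifold M" and met: "riemannian_metric M" and lc: "levi_civita M"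
    using assms(1) by (auto simp: riemannian_manifold_def)
  have const: "cov (conn M c) (\<lambda>_. u) (\<lambda>_. v) x = conn M c x u v" for x u v
    by (simp add: cov_def)
  show ?thesis
  proof
    show "open (coords c)" using man assms(2) by (auto simp: smooth_manifold_def)
    fix x assume x: "x \<in> coords c"
    show "bilinear (met M c x)" "met M c x u v = met M c x v u" "u \<noteq> 0 \<Longrightarrow> 0 < met M c x u u" for u v
      using met assms(2) x by (auto simp: riemannian_metric_def)
    show "bilinear (conn M c x)"
      using lc assms(2) x by (auto simp: levi_civita_def)
    show "conn M c x u v = conn M c x v u" for u v
    proof -
      have "cov (conn M c) (\<lambda>_. u) (\<lambda>_. v) x - cov (conn M c) (\<lambda>_. v) (\<lambda>_. u) x =
          lie (\<lambda>_. u) (\<lambda>_. v) x"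
        using lc assms(2) x smooth_on_const unfolding levi_civita_def by blast
      then show ?thesis by (simp add: const lie_def)
    qed
    show "D (\<lambda>y. met M c y v w) x u = met M c x (conn M c x u v) w + met M c x v (conn M c x u w)"
      for u v w
    proof -
      have "\<forall>X Y Z. smooth_on (coords c) X \<and> smooth_on (coords c) Y \<and> smooth_on (coords c) Z \<longrightarrow>
        (\<forall>x\<in>coords c. D (\<lambda>y. met M c y (Y y) (Z y)) x (X x) =
          met M c x (cov (conn M c) X Y x) (Z x) + met M c x (Y x) (cov (conn M c) X Z x))"
        using lc assms(2) unfolding levi_civita_def by blast
      from this[rule_format, of "\<lambda>_. u" "\<lambda>_. v" "\<lambda>_. w" x]
      show ?thesis using x by (simp add: const smooth_on_const)
    qed
  next
    show "smooth_on (coords c) (\<lambda>x. met M c x u v)" for u v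
      using met assms(2) by (auto simp: riemannian_metric_def)
    show "smooth_on (coords c) (\<lambda>x. conn M c x u v)" for u v
      using lc assms(2) by (auto simp: levi_civita_def)
  qed
qed

lemma kaehler_manifold_chart:
  assumes "kaehler_manifold N J" "d \<in> charts N"
  shows "kaehler_chart (coords d) (met N d) (conn N d) (J d)"
proof -
  interpret levi_civita_chart "coords d" "met N d" "conn N d"
    using assms by (intro riemannian_manifold_chart) (auto simp: kaehler_manifold_def)
  show ?thesis
  proof (intro kaehler_chart.intro kaehler_chart_axioms.intro levi_civita_chart_axioms)
    fix x assume x: "x \<in> coords d"
    show "linear (J d x)" "J d x (J d x u) = - u" "met N d x (J d x u) (J d x v) = met N d x u v"
      for u v
      using assms x by (auto simp: kaehler_manifold_def)
    show "D (\<lambda>y. J d y v) x u + conn N d x u (J d x v) = J d x (conn N d x u v)" for u v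
    proof -
      have "\<forall>X Y. smooth_on (coords d) X \<and> smooth_on (coords d) Y \<longrightarrow>
        (\<forall>x\<in>coords d. cov (conn N d) X (\<lambda>y. J d y (Y y)) x = J d x (cov (conn N d) X Y x))"
        using assms unfolding kaehler_manifold_def by blast
      from this[rule_format, of "\<lambda>_. u" "\<lambda>_. v" x]
      show ?thesis using x by (simp add: cov_def smooth_on_const)
    qed
  next
    show "smooth_on (coords d) (\<lambda>x. J d x u)" for u
      using assms by (auto simp: kaehler_manifold_def)
  qed
qed

lemma framed_lagrangian_chart:
  fixes M :: "('p, 'v::euclidean_space) manifold"
    and N :: "('q, 'e::euclidean_space) manifold"
  assumes N: "complex_space_form N J (4 * \<epsilon>)" and M: "riemannian_manifold M"
    and iso: "isometric_immersion M N \<phi>" and lag: "lagrangian M N J \<phi>"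
    and c: "c \<in> charts M" and d: "d \<in> charts N"
    and frame: "orthonormal_frame M c W e" and W: "W \<subseteq> local_dom c d \<phi>"
  shows "framed_lagrangian_chart (coords c) (met M c) (conn M c) (coords d) (met N d) (conn N d)
    W (local_rep c d \<phi>) e (J d) \<epsilon>"
proof -
  have kaehler: "kaehler_manifold N J" using N by (simp add: complex_space_form_def)
  interpret M: levi_civita_chart "coords c" "met M c" "conn M c"
    using riemannian_manifold_chart[OF M c] .
  interpret N: kaehler_chart "coords d" "met N d" "conn N d" "J d"
    using kaehler_manifold_chart[OF kaehler d] .
  show ?thesis
  proof
    show "open W" "W \<subseteq> coords c" using frame by (auto simp: orthonormal_frame_def)
    have "smooth_on (local_dom c d \<phi>) (local_rep c d \<phi>)"
      using iso c d by (auto simp: isometric_immersion_def)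
    then show "smooth_on W (local_rep c d \<phi>)" using W by (rule smooth_on_subset)
    show "DIM('e) = 2 * DIM('v)" using lag by (simp add: lagrangian_def)
    show "smooth_on W (e i)" if "i < DIM('v)" for i
      using that frame by (auto simp: orthonormal_frame_def)
    show "sectional_curvature (met N d) (conn N d) y s (J d y s) = 4 * \<epsilon>"
      if "y \<in> coords d" "s \<noteq> 0" for y s
      using N d that by (auto simp: complex_space_form_def)
  next
    fix x assume x: "x \<in> W"
    then have dom: "x \<in> local_dom c d \<phi>" using W by auto
    show "local_rep c d \<phi> x \<in> coords d"
      using local_rep_in_coords[OF _ c dom] M by (simp add: riemannian_manifold_def)
    show "met M c x u v = met N d (local_rep c d \<phi> x)
        (D (local_rep c d \<phi>) x u) (D (local_rep c d \<phi>) x v)" for u v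
      using iso c d dom by (auto simp: isometric_immersion_def)
    show "met N d (local_rep c d \<phi> x)
        (J d (local_rep c d \<phi> x) (D (local_rep c d \<phi>) x u)) (D (local_rep c d \<phi>) x v) = 0" for u v
      using lag c d dom by (auto simp: lagrangian_def)
    show "met M c x (e i x) (e j x) = (if i = j then 1 else 0)" if "i < DIM('v)" "j < DIM('v)" for i j
      using that frame x by (auto simp: orthonormal_frame_def)
  qed
qed

lemma holds_onI:
  assumes "\<And>c d W e x. c \<in> charts M \<Longrightarrow> d \<in> charts N \<Longrightarrow> orthonormal_frame M c W e \<Longrightarrow>
    W \<subseteq> local_dom c d \<phi> \<Longrightarrow> x \<in> W \<Longrightarrow> P c d e x"
  shows "holds_on M N \<phi> P"
  unfolding holds_on_def
proof (intro ballI allI impI, elim conjE)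
  fix c d W e x
  assume "c \<in> charts M" "d \<in> charts N" "x \<in> W" "orthonormal_frame M c W e" "W \<subseteq> local_dom c d \<phi>"
  then show "P c d e x" by (intro assms)
qed

lemma holds_onD:
  assumes "holds_on M N \<phi> P" "c \<in> charts M" "d \<in> charts N" "orthonormal_frame M c W e"
    "W \<subseteq> local_dom c d \<phi>" "x \<in> W"
  shows "P c d e x"
  using assms(1)[unfolded holds_on_def, rule_format, OF assms(2,3) conjI[OF assms(4,5)] assms(6)] .

lemma holds_on_conj_iff:
  assumes "\<And>c d W e x. c \<in> charts M \<Longrightarrow> d \<in> charts N \<Longrightarrow> orthonormal_frame M c W e \<Longrightarrow>
    W \<subseteq> local_dom c d \<phi> \<Longrightarrow> x \<in> W \<Longrightarrow> P c d e x \<longleftrightarrow> Q c d e x \<and> R c d e x"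
  shows "holds_on M N \<phi> P \<longleftrightarrow> holds_on M N \<phi> Q \<and> holds_on M N \<phi> R"
proof
  assume P: "holds_on M N \<phi> P"
  have Q: "Q c d e x" and R: "R c d e x"
    if "c \<in> charts M" "d \<in> charts N" "orthonormal_frame M c W e" "W \<subseteq> local_dom c d \<phi>" "x \<in> W"
    for c d W e x
    using assms[OF that] holds_onD[OF P that] by simp_all
  show "holds_on M N \<phi> Q \<and> holds_on M N \<phi> R"
    using holds_onI[of M N \<phi> Q, OF Q] holds_onI[of M N \<phi> R, OF R] by (rule conjI)
next
  assume QR: "holds_on M N \<phi> Q \<and> holds_on M N \<phi> R"
  show "holds_on M N \<phi> P"
  proof (rule holds_onI)
    fix c d W e x
    assume that: "c \<in> charts M" "d \<in> charts N" "orthonormal_frame M c W e"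
      "W \<subseteq> local_dom c d \<phi>" "x \<in> W"
    show "P c d e x"
      using assms[OF that] holds_onD[OF conjunct1[OF QR] that] holds_onD[OF conjunct2[OF QR] that]
      by simp
  qed
qed

theorem proposition3p1:
  fixes M :: "('p, 'v::euclidean_space) manifold"
    and N :: "('q, 'e::euclidean_space) manifold"
    and J :: "('q, 'e) chart \<Rightarrow> 'e \<Rightarrow> 'e \<Rightarrow> 'e"
    and \<phi> :: "'p \<Rightarrow> 'q"
    and \<epsilon> :: real
  assumes "complex_space_form N J (4 * \<epsilon>)"
    and "riemannian_manifold M"
    and "isometric_immersion M N \<phi>"
    and "lagrangian M N J \<phi>"
  shows "biharmonic M N \<phi> \<longleftrightarrow>
    holds_on M N \<phi> (\<lambda>c d e x.
      let \<Gamma> = conn M c; h = met N d; \<Gamma>' = conn N d; f = local_rep c d \<phi>;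
          H = mean_curv \<Gamma> \<Gamma>' f e
      in (\<Sum>i<DIM('v). cov_shape \<Gamma> h \<Gamma>' f H (e i) (e i) x)
          + (\<Sum>i<DIM('v). shape h \<Gamma>' f (ncov h \<Gamma>' f (e i) H) (e i) x) = 0)
    \<and> holds_on M N \<phi> (\<lambda>c d e x.
      let \<Gamma> = conn M c; h = met N d; \<Gamma>' = conn N d; f = local_rep c d \<phi>;
          H = mean_curv \<Gamma> \<Gamma>' f e
      in normal_laplacian \<Gamma> h \<Gamma>' f e H x
          + (\<Sum>i<DIM('v). second_ff \<Gamma> \<Gamma>' f (shape h \<Gamma>' f H (e i)) (e i) x)
          - ((real DIM('v) + 3) * \<epsilon>) *\<^sub>R H x = 0)"
  unfolding biharmonic_def Let_def
proof (rule holds_on_conj_iff, goal_cases)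
  case (1 c d W e x)
  interpret framed_lagrangian_chart "coords c" "met M c" "conn M c" "coords d" "met N d" "conn N d"
    W "local_rep c d \<phi>" e "J d" \<epsilon>
    using framed_lagrangian_chart[OF assms 1(1-4)] .
  show ?case by (rule biharmonic_iff_components[OF 1(5)])
qed

end
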